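(* Let $d\ge1$, let $\Omega\subset\mathbb R^d$ be a bounded Lipschitz polyhedral domain, and let $\rho$, $P$, $\mathscr Z_q$, $\rho^{\rm av}$, $\mathcal T_h$, $\widehat{\mathcal T}_h$, $g_{\delta,h}$ be as described in the context, with kernel constants $M_\rho,\rho_*>0$, $0<r_*\le1$. Then the averaged kernel $\rho^{\rm av}$, extended by zero outside $P$, is even, nonnegative, and satisfies $$\|\rho^{\rm av}\|_{L^1(B_1)}\le M_\rho,\qquad \rho^{\rm av}(z)\ge\rho_*\quad\text{for a.e. }z\in B_{r_*/2}.$$ Moreover, for every $\delta>0$ the matrix $A_h$ is symmetric positive definite, and the pair-cell assembly evaluates $A_h$ and the lifting contribution to $b_h$ exactly, i.e. $$A_h=\sum_\nu c_\nu d_\nu d_\nu^T,\qquad (b_h^{\rm lift})_i=-\sum_\nu c_\nu e_\nu (d_\nu)_i\quad(1\le i\le N_h).$$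
   Context: $B_r$ is the open ball of radius $r$ centered at $0$; $E_0v$ is the extension by zero to $\mathbb R^d$ of a function $v$ on $\Omega$. Kernel: $\rho\in L^1(B_1)$, $\rho(z)=\rho(-z)$, $\rho\ge0$ a.e. in $B_1$, $\|\rho\|_{L^1(B_1)}\le M_\rho$, and $\rho\ge\rho_*$ a.e. in $B_{r_*}$. Polytope and partition: $P\subset\mathbb R^d$ is a $d$-dimensional polytope with $P=-P$ and $B_{1/2}\subset P\subset\overline{B_1}$. $\mathscr Z_q$ is a finite partition of $P$ into polytopal cells $Z$ of positive measure, covering $P$ without positive-measure overlap, with $Z\in\mathscr Z_q\Rightarrow -Z\in\mathscr Z_q$, and $q:=\max_{Z}\operatorname{diam}Z$ satisfies $0<q\le r_*/2$. The averaged kernel is $\rho^{\rm av}|_Z=\mu_Z/|Z|$ with $\mu_Z=\int_{Z\cap B_1}\rho(z)\,dz$. Domains: for $\delta>0$, $\Omega_{I,P}^\delta=\{y\notin\Omega:\ y\in x+\delta P\text{ for some }x\in\Omega\}$, $\widehat\Omega_{\delta,P}=\Omega\cup\Omega_{I,P}^\delta$, and $$\mathcal I_{\delta,P}=\{(x,y)\in(\widehat\Omega_{\delta,P})^2:\ (x\in\Omega\text{ or }y\in\Omega),\ y-x\in\delta P\}.$$ Meshes and finite elements: $\mathcal T_h$ is a conforming simplicial mesh of $\Omega$ fitted to $\partial\Omega$, with maximal element diameter $h$, from a uniformly shape-regular and globally quasi-uniform family. $V_h^0$ is the space of continuous functions on $\overline\Omega$ that are affine on each $T\in\mathcal T_h$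 and vanish on $\partial\Omega$, with nodal basis $\{\phi_i\}_{i=1}^{N_h}$. $\widehat{\mathcal T}_h$ is a conforming simplicial mesh of $\widehat\Omega_{\delta,P}$ extending $\mathcal T_h$, with $\partial\Omega$ as an element interface. $g_{\delta,h}$ is a given function on $\Omega_{I,P}^\delta$ that is affine on each element of $\widehat{\mathcal T}_h$ contained in $\Omega_{I,P}^\delta$; the discrete lifting is $\ell_{\delta,h}=0$ in $\Omega$, $\ell_{\delta,h}=g_{\delta,h}$ in $\Omega_{I,P}^\delta$. Matrix and lifting contribution to the load vector: $$(A_h)_{ij}=\delta^{-(d+2)}\int_{\mathcal I_{\delta,P}}\rho^{\rm av}\!\left(\tfrac{y-x}\delta\right)\bigl(E_0\phi_j(y)-E_0\phi_j(x)\bigr)\bigl(E_0\phi_i(y)-E_0\phi_i(x)\bigr)\,dy\,dx,$$ $$(b_h^{\rm lift})_i=-\delta^{-(d+2)}\int_{\mathcal I_{\delta,P}}\rho^{\rm av}\!\left(\tfrac{y-x}\delta\right)\bigl(\ell_{\delta,h}(y)-\ell_{\delta,h}(x)\bigr)\bigl(E_0\phi_i(y)-E_0\phi_i(x)\bigr)\,dy\,dx .$$ (The full load vector is $(b_h)_i=(f,\phi_i)_{L^2(\Omega)}+(b_h^{\rm lift})_i$ for a source $f\in L^2(\Omega)$.) Pair-cell assembly: for $T,S\in\widehat{\mathcal T}_h$ and $Z\in\mathscr Z_q$ the pair cell is $\mathcal C_{TSZ}=\{(x,y)\in(T\times S)\cap\mathcal I_{\delta,P}:(y-x)/\delta\in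 Z\}\subset\mathbb R^{2d}$. Each pair cell (of positive measure) is partitioned into nonoverlapping $2d$-simplices. On each such simplex $R=\operatorname{conv}\{v_0,\dots,v_{2d}\}$ one uses the quadrature nodes and weights $$\zeta_i=\theta_dv_i+\vartheta_d\sum_{j\ne i}v_j,\quad \omega_i=\frac{|R|}{2d+1},\quad i=0,\dots,2d,\qquad \theta_d=\frac{1+2d/\sqrt{2d+2}}{2d+1},\quad \vartheta_d=\frac{1-1/\sqrt{2d+2}}{2d+1}.$$ The index $\nu$ runs over all quadrature nodes of all simplices of all pair cells; node $\nu$ has coordinates $(x_\nu,y_\nu)$ and weight $\omega_\nu$, and $Z(\nu)$ is the kernel cell of its parent pair cell. Set $(d_\nu)_i=E_0\phi_i(y_\nu)-E_0\phi_i(x_\nu)$, $e_\nu=\ell_{\delta,h}(y_\nu)-\ell_{\delta,h}(x_\nu)$, and $c_\nu=\delta^{-(d+2)}\bigl(\rho^{\rm av}|_{Z(\nu)}\bigr)\omega_\nu$. *)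

theory Defs
  imports "HOL-Analysis.Analysis"
begin

section \<open>Lipschitz polyhedral domains\<close>

text \<open>Near each boundary point the domain is, in a rotated coordinate system with last axis
  \<open>e\<close>, the strict epigraph of a Lipschitz function. The function \<open>\<gamma>\<close> is only ever evaluated at
  projections onto the hyperplane orthogonal to \<open>e\<close>.\<close>

definition lipschitz_boundary :: "'a::euclidean_space set \<Rightarrow> bool" where
  "lipschitz_boundary \<Omega> \<longleftrightarrow>
     (\<forall>x\<in>frontier \<Omega>. \<exists>U e \<gamma> L. open U \<and> x \<in> U \<and> norm e = 1 \<and>
        L-lipschitz_on {w. w \<bullet> e = 0} (\<gamma> :: 'a \<Rightarrow> real) \<and>
        \<Omega> \<inter> U = {y \<in> U. \<gamma> (y - (y \<bullet> e) *\<^sub>R e) < y \<bullet> e})"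

definition polyhedral_boundary :: "'a::euclidean_space set \<Rightarrow> bool" where
  "polyhedral_boundary \<Omega> \<longleftrightarrow>
     (\<exists>\<F>. finite \<F> \<and> (\<forall>F\<in>\<F>. polytope F \<and> aff_dim F = int DIM('a) - 1) \<and>
          frontier \<Omega> = \<Union>\<F>)"

definition lipschitz_polyhedral_domain :: "'a::euclidean_space set \<Rightarrow> bool" where
  "lipschitz_polyhedral_domain \<Omega> \<longleftrightarrow>
     open \<Omega> \<and> connected \<Omega> \<and> \<Omega> \<noteq> {} \<and> bounded \<Omega> \<and>
     lipschitz_boundary \<Omega> \<and> polyhedral_boundary \<Omega>"


section \<open>The averaged kernel\<close>

definition polytopal_partition :: "'a::euclidean_space set \<Rightarrow> 'a set set \<Rightarrow> bool" where
  "polytopal_partition P \<Z> \<longleftrightarrow>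
     finite \<Z> \<and> \<Union>\<Z> = P \<and>
     (\<forall>Z\<in>\<Z>. polytope Z \<and> 0 < measure lebesgue Z) \<and>
     pairwise (\<lambda>Z Z'. negligible (Z \<inter> Z')) \<Z>"

definition cell_mass :: "('a::euclidean_space \<Rightarrow> real) \<Rightarrow> 'a set \<Rightarrow> real" where
  "cell_mass \<rho> Z = (LINT z:Z \<inter> ball 0 1|lebesgue. \<rho> z)"

definition cell_average :: "('a::euclidean_space \<Rightarrow> real) \<Rightarrow> 'a set \<Rightarrow> real" where
  "cell_average \<rho> Z = cell_mass \<rho> Z / measure lebesgue Z"

text \<open>The cells may share boundary points, so the piecewise constant kernel is determined only up
  to a null set. The representative below has the cell average as its value in the interior of a
  cell and vanishes everywhere else, in particular outside the polytope; at most one summand is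
  nonzero at any point.\<close>

definition averaged_kernel ::
  "('a::euclidean_space \<Rightarrow> real) \<Rightarrow> 'a set set \<Rightarrow> 'a \<Rightarrow> real" where
  "averaged_kernel \<rho> \<Z> z = (\<Sum>Z\<in>\<Z>. cell_average \<rho> Z * indicat_real (interior Z) z)"


section \<open>Nonlocal domains\<close>

definition interaction_collar :: "'a::euclidean_space set \<Rightarrow> 'a set \<Rightarrow> real \<Rightarrow> 'a set" where
  "interaction_collar \<Omega> P \<delta> = {y. y \<notin> \<Omega> \<and> (\<exists>x\<in>\<Omega>. \<exists>p\<in>P. y = x + \<delta> *\<^sub>R p)}"

definition extended_domain :: "'a::euclidean_space set \<Rightarrow> 'a set \<Rightarrow> real \<Rightarrow> 'a set" where
  "extended_domain \<Omega> P \<delta> = \<Omega> \<union> interaction_collar \<Omega> P \<delta>"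

definition interaction_pairs ::
  "'a::euclidean_space set \<Rightarrow> 'a set \<Rightarrow> real \<Rightarrow> ('a \<times> 'a) set" where
  "interaction_pairs \<Omega> P \<delta> =
     {(x, y). x \<in> extended_domain \<Omega> P \<delta> \<and> y \<in> extended_domain \<Omega> P \<delta> \<and>
              (x \<in> \<Omega> \<or> y \<in> \<Omega>) \<and> y - x \<in> (*\<^sub>R) \<delta> ` P}"

definition zero_ext :: "'a set \<Rightarrow> ('a \<Rightarrow> real) \<Rightarrow> 'a \<Rightarrow> real" where
  "zero_ext \<Omega> v x = (if x \<in> \<Omega> then v x else 0)"


section \<open>Meshes and finite elements\<close>

definition conforming_mesh :: "'a::euclidean_space set \<Rightarrow> 'a set set \<Rightarrow> bool" where
  "conforming_mesh D \<T> \<longleftrightarrow>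
     triangulation \<T> \<and> (\<forall>T\<in>\<T>. int DIM('a) simplex T) \<and> \<Union>\<T> = closure D"

definition mesh_size :: "'a::euclidean_space set set \<Rightarrow> real" where
  "mesh_size \<T> = Max (diameter ` \<T>)"

definition inradius :: "'a::euclidean_space set \<Rightarrow> real" where
  "inradius T = Sup {r. 0 \<le> r \<and> (\<exists>c. cball c r \<subseteq> T)}"

definition uniformly_shape_regular :: "'a::euclidean_space set set set \<Rightarrow> bool" where
  "uniformly_shape_regular \<TT> \<longleftrightarrow>
     (\<exists>\<sigma>>0. \<forall>\<T>\<in>\<TT>. \<forall>T\<in>\<T>. diameter T \<le> \<sigma> * inradius T)"

definition globally_quasi_uniform :: "'a::euclidean_space set set set \<Rightarrow> bool" where
  "globally_quasi_uniform \<TT> \<longleftrightarrow>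
     (\<exists>\<kappa>>0. \<forall>\<T>\<in>\<TT>. \<forall>T\<in>\<T>. mesh_size \<T> \<le> \<kappa> * diameter T)"

definition affine_fun_on :: "'a::euclidean_space set \<Rightarrow> ('a \<Rightarrow> real) \<Rightarrow> bool" where
  "affine_fun_on X v \<longleftrightarrow> (\<exists>a b. \<forall>x\<in>X. v x = a \<bullet> x + b)"

definition fe_space :: "'a::euclidean_space set \<Rightarrow> 'a set set \<Rightarrow> ('a \<Rightarrow> real) set" where
  "fe_space \<Omega> \<T> =
     {v. continuous_on (closure \<Omega>) v \<and> (\<forall>T\<in>\<T>. affine_fun_on T v) \<and>
         (\<forall>x\<in>frontier \<Omega>. v x = 0)}"

definition interior_nodes :: "'a::euclidean_space set \<Rightarrow> 'a set set \<Rightarrow> 'a set" where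
  "interior_nodes \<Omega> \<T> = {z \<in> \<Omega>. \<exists>T\<in>\<T>. z extreme_point_of T}"

definition nodal_basis ::
  "'a::euclidean_space set \<Rightarrow> 'a set set \<Rightarrow> nat \<Rightarrow> (nat \<Rightarrow> 'a \<Rightarrow> real) \<Rightarrow> bool" where
  "nodal_basis \<Omega> \<T> N \<phi> \<longleftrightarrow>
     (\<exists>z. bij_betw z {1..N} (interior_nodes \<Omega> \<T>) \<and>
        (\<forall>i\<in>{1..N}. \<phi> i \<in> fe_space \<Omega> \<T> \<and>
           (\<forall>j\<in>{1..N}. \<phi> i (z j) = (if i = j then 1 else 0))))"

definition extension_mesh ::
  "'a::euclidean_space set \<Rightarrow> 'a set \<Rightarrow> real \<Rightarrow> 'a set set \<Rightarrow> 'a set set \<Rightarrow> bool" where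
  "extension_mesh \<Omega> P \<delta> \<T> \<T>' \<longleftrightarrow>
     conforming_mesh (extended_domain \<Omega> P \<delta>) \<T>' \<and> \<T> \<subseteq> \<T>' \<and>
     (\<exists>\<F>. (\<forall>F\<in>\<F>. \<exists>T\<in>\<T>'. F facet_of T) \<and> frontier \<Omega> = \<Union>\<F>)"

text \<open>Elements are closed, whereas the extended domain is open, so an element of the collar is one
  contained in the closure of the collar. No continuity across element boundaries is imposed on the
  data.\<close>

definition collar_data ::
  "'a::euclidean_space set \<Rightarrow> 'a set \<Rightarrow> real \<Rightarrow> 'a set set \<Rightarrow> ('a \<Rightarrow> real) \<Rightarrow> bool" where
  "collar_data \<Omega> P \<delta> \<T>' g \<longleftrightarrow>
     (\<forall>T\<in>\<T>'. T \<subseteq> closure (interaction_collar \<Omega> P \<delta>) \<longrightarrow>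
        affine_fun_on (interior T \<inter> interaction_collar \<Omega> P \<delta>) g)"

definition lifting ::
  "'a::euclidean_space set \<Rightarrow> 'a set \<Rightarrow> real \<Rightarrow> ('a \<Rightarrow> real) \<Rightarrow> 'a \<Rightarrow> real" where
  "lifting \<Omega> P \<delta> g = zero_ext (interaction_collar \<Omega> P \<delta>) g"


section \<open>Stiffness matrix and lifting contribution\<close>

definition nonlocal_form ::
  "('a::euclidean_space \<Rightarrow> real) \<Rightarrow> 'a set \<Rightarrow> 'a set \<Rightarrow> real \<Rightarrow> ('a \<Rightarrow> real) \<Rightarrow> ('a \<Rightarrow> real) \<Rightarrow> real" where
  "nonlocal_form \<kappa> \<Omega> P \<delta> u v =
     1 / \<delta> ^ (DIM('a) + 2) *
     (LINT p:interaction_pairs \<Omega> P \<delta>|lebesgue.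
        case p of (x, y) \<Rightarrow> \<kappa> ((y - x) /\<^sub>R \<delta>) * (u y - u x) * (v y - v x))"

definition stiffness_matrix ::
  "('a::euclidean_space \<Rightarrow> real) \<Rightarrow> 'a set \<Rightarrow> 'a set \<Rightarrow> real \<Rightarrow> (nat \<Rightarrow> 'a \<Rightarrow> real) \<Rightarrow> nat \<Rightarrow> nat \<Rightarrow> real" where
  "stiffness_matrix \<kappa> \<Omega> P \<delta> \<phi> i j =
     nonlocal_form \<kappa> \<Omega> P \<delta> (zero_ext \<Omega> (\<phi> j)) (zero_ext \<Omega> (\<phi> i))"

definition lifting_load ::
  "('a::euclidean_space \<Rightarrow> real) \<Rightarrow> 'a set \<Rightarrow> 'a set \<Rightarrow> real \<Rightarrow> ('a \<Rightarrow> real) \<Rightarrow> (nat \<Rightarrow> 'a \<Rightarrow> real) \<Rightarrow> nat \<Rightarrow> real" where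
  "lifting_load \<kappa> \<Omega> P \<delta> g \<phi> i =
     - nonlocal_form \<kappa> \<Omega> P \<delta> (lifting \<Omega> P \<delta> g) (zero_ext \<Omega> (\<phi> i))"

definition sym_positive_definite :: "nat \<Rightarrow> (nat \<Rightarrow> nat \<Rightarrow> real) \<Rightarrow> bool" where
  "sym_positive_definite N A \<longleftrightarrow>
     (\<forall>i\<in>{1..N}. \<forall>j\<in>{1..N}. A i j = A j i) \<and>
     (\<forall>c. (\<exists>i\<in>{1..N}. c i \<noteq> 0) \<longrightarrow> 0 < (\<Sum>i=1..N. \<Sum>j=1..N. c i * A i j * c j))"


section \<open>Pair-cell assembly\<close>

definition pair_cell ::
  "'a::euclidean_space set \<Rightarrow> 'a set \<Rightarrow> real \<Rightarrow> 'a set \<Rightarrow> 'a set \<Rightarrow> 'a set \<Rightarrow> ('a \<times> 'a) set" where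
  "pair_cell \<Omega> P \<delta> T S Z =
     {(x, y). (x, y) \<in> (T \<times> S) \<inter> interaction_pairs \<Omega> P \<delta> \<and> (y - x) /\<^sub>R \<delta> \<in> Z}"

text \<open>Pair cells need not be closed because \<open>\<Omega>\<close> is open, so a partition of a set into closed
  simplices is one covering its closure.\<close>

definition simplicial_partition :: "'b::euclidean_space set \<Rightarrow> 'b set set \<Rightarrow> bool" where
  "simplicial_partition C \<R> \<longleftrightarrow>
     finite \<R> \<and> (\<forall>R\<in>\<R>. int DIM('b) simplex R) \<and>
     pairwise (\<lambda>R R'. negligible (R \<inter> R')) \<R> \<and> \<Union>\<R> = closure C"

definition pair_cell_subdivision ::
  "'a::euclidean_space set \<Rightarrow> 'a set \<Rightarrow> real \<Rightarrow> 'a set set \<Rightarrow> 'a set set \<Rightarrow>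
     ('a set \<Rightarrow> 'a set \<Rightarrow> 'a set \<Rightarrow> ('a \<times> 'a) set set) \<Rightarrow> bool" where
  "pair_cell_subdivision \<Omega> P \<delta> \<T>' \<Z> \<R> \<longleftrightarrow>
     (\<forall>T\<in>\<T>'. \<forall>S\<in>\<T>'. \<forall>Z\<in>\<Z>. 0 < measure lebesgue (pair_cell \<Omega> P \<delta> T S Z) \<longrightarrow>
        simplicial_partition (pair_cell \<Omega> P \<delta> T S Z) (\<R> T S Z))"

definition quad_theta :: "nat \<Rightarrow> real" where
  "quad_theta d = (1 + 2 * real d / sqrt (2 * real d + 2)) / (2 * real d + 1)"

definition quad_vartheta :: "nat \<Rightarrow> real" where
  "quad_vartheta d = (1 - 1 / sqrt (2 * real d + 2)) / (2 * real d + 1)"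

text \<open>A quadrature index \<open>(T, S, Z, R, v)\<close> consists of the parent pair cell, a simplex of its
  subdivision and a vertex of that simplex; the vertices of a simplex are its extreme points.\<close>

type_synonym 'a quad_index = "'a set \<times> 'a set \<times> 'a set \<times> ('a \<times> 'a) set \<times> ('a \<times> 'a)"

definition quad_indices ::
  "'a::euclidean_space set \<Rightarrow> 'a set \<Rightarrow> real \<Rightarrow> 'a set set \<Rightarrow> 'a set set \<Rightarrow>
     ('a set \<Rightarrow> 'a set \<Rightarrow> 'a set \<Rightarrow> ('a \<times> 'a) set set) \<Rightarrow> 'a quad_index set" where
  "quad_indices \<Omega> P \<delta> \<T>' \<Z> \<R> =
     {(T, S, Z, R, v). T \<in> \<T>' \<and> S \<in> \<T>' \<and> Z \<in> \<Z> \<and>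
        0 < measure lebesgue (pair_cell \<Omega> P \<delta> T S Z) \<and> R \<in> \<R> T S Z \<and> v extreme_point_of R}"

fun quad_node :: "'a::euclidean_space quad_index \<Rightarrow> 'a \<times> 'a" where
  "quad_node (T, S, Z, R, v) =
     quad_theta DIM('a) *\<^sub>R v +
     quad_vartheta DIM('a) *\<^sub>R (\<Sum>w\<in>{w. w extreme_point_of R} - {v}. w)"

fun quad_weight :: "'a::euclidean_space quad_index \<Rightarrow> real" where
  "quad_weight (T, S, Z, R, v) = measure lebesgue R / (2 * real DIM('a) + 1)"

fun quad_cell :: "'a quad_index \<Rightarrow> 'a set" where
  "quad_cell (T, S, Z, R, v) = Z"

definition node_coeff ::
  "('a::euclidean_space \<Rightarrow> real) \<Rightarrow> real \<Rightarrow> 'a quad_index \<Rightarrow> real" where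
  "node_coeff \<rho> \<delta> \<nu> =
     1 / \<delta> ^ (DIM('a) + 2) * cell_average \<rho> (quad_cell \<nu>) * quad_weight \<nu>"

definition node_diff :: "('a::euclidean_space \<Rightarrow> real) \<Rightarrow> 'a quad_index \<Rightarrow> real" where
  "node_diff u \<nu> = (case quad_node \<nu> of (x, y) \<Rightarrow> u y - u x)"

end

theory Submission
  imports Defs
begin

text \<open>Evenness, nonnegativity and the bounds for the averaged kernel are inherited cell by cell; the
  lower bound uses that a cell meeting the ball of radius \<open>r\<^sub>s / 2\<close> lies in the ball of radius
  \<open>r\<^sub>s\<close>. If the quadratic form vanishes at a finite element function, its zero extension is
  continuous and locally constant at the fixed scale \<open>\<delta> r\<^sub>s / 2\<close> around every point of the domain,
  hence constant on the whole space, hence zero. For the assembly, the interiors of the quadrature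
  simplices exhaust the interaction pairs up to a null set, and on each of them the integrand is
  a cell average times a product of two affine functions. The quadrature rule is exact for such
  products, since the second moments of barycentric coordinates over an \<open>n\<close>-simplex \<open>R\<close> are
  \<open>|R| (1 + \<delta>\<^sub>i\<^sub>j) / ((n + 1) (n + 2))\<close>.\<close>

section \<open>Quadrature on simplices\<close>

text \<open>The obstacle to exactness lies at boundaries: \<open>averaged_kernel\<close> vanishes on
  cell boundaries, the lifting may jump across the boundary of \<open>\<Omega>\<close>, and the
  simplices fill the closure of a pair cell, not the cell itself. All identities are therefore
  proved on open simplices. The rule still samples the right values because every node has strictly
  positive barycentric coordinates and so lies in the open simplex. The Lipschitz boundary enters
  through one fact: \<open>\<Omega>\<close> is the interior of its closure, which places the
  interiors of mesh elements inside \<open>\<Omega>\<close>. The constants come from contracting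
  each vertex towards the barycentre. With \<open>n = 2 d\<close> and
  \<open>s = sqrt (n + 2)\<close>, a node is \<open>1 / s\<close> times the vertex plus
  \<open>1 - 1 / s\<close> times the barycentre. This ratio turns the sum over nodes of
  \<open>f g\<close> into the combination of vertex values produced by the second moments, for
  affine \<open>f\<close> and \<open>g\<close>.\<close>

lemma barycentric_coordinate_exists:
  fixes C :: "'b::euclidean_space set"
  assumes "\<not> affine_dependent C" "a \<in> C"
  obtains w \<beta> where "w \<bullet> a + \<beta> = (1::real)" "\<And>c. c \<in> C \<Longrightarrow> c \<noteq> a \<Longrightarrow> w \<bullet> c + \<beta> = 0"
proof -
  let ?B = "(\<lambda>x. - a + x) ` (C - {a})"
  have "independent ?B"
    using assms affine_dependent_iff_dependent2 by blast
  then obtain g :: "'b \<Rightarrow> real" where g: "linear g" "\<And>x. x \<in> ?B \<Longrightarrow> g x = 1"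
    using linear_independent_extend[of ?B "\<lambda>_. 1::real"] by metis
  \<comment> \<open>\<open>g\<close> equals 1 on every difference \<open>c - a\<close>, and
    \<open>adjoint g 1\<close> is its Riesz vector. The sign makes the affine function drop by 1
    from \<open>a\<close> to every other vertex.\<close>
  define w where "w = - adjoint g 1"
  have gw: "g x = - (w \<bullet> x)" for x
    using adjoint_works[OF g(1), of x 1] by (simp add: w_def inner_commute)
  show thesis
  proof (rule that[of w "1 - w \<bullet> a"])
    show "w \<bullet> c + (1 - w \<bullet> a) = 0" if "c \<in> C" "c \<noteq> a" for c
      using g(2)[of "- a + c"] that gw[of "- a + c"] by (simp add: inner_simps)
  qed simp
qed

lemma affine_sum_combination:
  fixes w :: "'b::euclidean_space"
  assumes "sum u C = (1::real)"
  shows "w \<bullet> (\<Sum>c\<in>C. u c *\<^sub>R c) + \<beta> = (\<Sum>c\<in>C. u c * (w \<bullet> c + \<beta>))"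
  by (simp add: inner_sum_right distrib_left sum.distrib flip: sum_distrib_right) (simp add: assms)

lemma barycentric_coordinate_eq:
  fixes C :: "'b::euclidean_space set"
  assumes "finite C" "a \<in> C" "sum u C = (1::real)"
    and "w \<bullet> a + \<beta> = (1::real)" "\<And>c. c \<in> C \<Longrightarrow> c \<noteq> a \<Longrightarrow> w \<bullet> c + \<beta> = 0"
  shows "w \<bullet> (\<Sum>c\<in>C. u c *\<^sub>R c) + \<beta> = u a"
proof -
  have "w \<bullet> (\<Sum>c\<in>C. u c *\<^sub>R c) + \<beta> = (\<Sum>c\<in>C. u c * (w \<bullet> c + \<beta>))"
    by (rule affine_sum_combination[OF assms(3)])
  also have "\<dots> = (\<Sum>c\<in>C. if c = a then u a else 0)"
    using assms by (intro sum.cong) auto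
  finally show ?thesis
    using assms by simp
qed

lemma barycentric_superlevel_set:
  fixes C :: "'b::euclidean_space set"
  assumes C: "finite C" "a \<in> C"
    and w: "w \<bullet> a + \<beta> = (1::real)" "\<And>c. c \<in> C \<Longrightarrow> c \<noteq> a \<Longrightarrow> w \<bullet> c + \<beta> = 0"
    and t: "0 \<le> t" "t < 1"
  shows "{x \<in> convex hull C. t \<le> w \<bullet> x + \<beta>} = (\<lambda>x. t *\<^sub>R a + (1 - t) *\<^sub>R x) ` (convex hull C)"
proof (intro equalityI subsetI)
  fix x assume "x \<in> {x \<in> convex hull C. t \<le> w \<bullet> x + \<beta>}"
  then obtain u where u: "\<And>c. c \<in> C \<Longrightarrow> 0 \<le> u c" "sum u C = 1" "x = (\<Sum>c\<in>C. u c *\<^sub>R c)"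
    and tx: "t \<le> w \<bullet> x + \<beta>"
    using convex_hull_finite[OF C(1)] by auto
  have ua: "t \<le> u a"
    using tx barycentric_coordinate_eq[OF C u(2) w] u(3) by simp
  \<comment> \<open>The inverse homothety in terms of weights: removing \<open>t\<close> from the
    weight of \<open>a\<close> leaves total mass \<open>1 - t\<close>. The superlevel condition is
    exactly what keeps the new weight of \<open>a\<close> nonnegative.\<close>
  define u' where "u' c = (u c - (if c = a then t else 0)) / (1 - t)" for c
  have "sum u' C = 1" "\<forall>c\<in>C. 0 \<le> u' c"
    using C u ua t unfolding u'_def
    by (auto simp: sum_subtractf simp flip: sum_divide_distrib)
  then have "(\<Sum>c\<in>C. u' c *\<^sub>R c) \<in> convex hull C"
    using convex_hull_finite[OF C(1)] by auto
  moreover have "t *\<^sub>R a + (1 - t) *\<^sub>R (\<Sum>c\<in>C. u' c *\<^sub>R c) = x"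
  proof -
    have "(1 - t) *\<^sub>R (\<Sum>c\<in>C. u' c *\<^sub>R c) = (\<Sum>c\<in>C. u c *\<^sub>R c - (if c = a then t *\<^sub>R a else 0))"
      unfolding scaleR_sum_right scaleR_scaleR
    proof (intro sum.cong refl)
      fix c
      have "(1 - t) * u' c = u c - (if c = a then t else 0)"
        using t by (simp add: u'_def)
      then show "((1 - t) * u' c) *\<^sub>R c = u c *\<^sub>R c - (if c = a then t *\<^sub>R a else 0)"
        by (simp add: scaleR_diff_left)
    qed
    also have "\<dots> = x - t *\<^sub>R a"
      using C u by (simp add: sum_subtractf)
    finally show ?thesis by simp
  qed
  ultimately show "x \<in> (\<lambda>x. t *\<^sub>R a + (1 - t) *\<^sub>R x) ` (convex hull C)"
    by force
next
  fix y assume "y \<in> (\<lambda>x. t *\<^sub>R a + (1 - t) *\<^sub>R x) ` (convex hull C)"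
  then obtain x where x: "x \<in> convex hull C" "y = t *\<^sub>R a + (1 - t) *\<^sub>R x"
    by auto
  then obtain u where u: "\<And>c. c \<in> C \<Longrightarrow> 0 \<le> u c" "sum u C = 1" "x = (\<Sum>c\<in>C. u c *\<^sub>R c)"
    using convex_hull_finite[OF C(1)] by auto
  have "0 \<le> w \<bullet> x + \<beta>"
    using barycentric_coordinate_eq[OF C u(2) w] u(1)[OF C(2)] u(3) by simp
  then have "0 \<le> (1 - t) * (w \<bullet> x + \<beta>)"
    using t by simp
  moreover have "w \<bullet> y + \<beta> = t * (w \<bullet> a + \<beta>) + (1 - t) * (w \<bullet> x + \<beta>)"
    by (simp add: x(2) inner_simps algebra_simps)
  ultimately have "t \<le> w \<bullet> y + \<beta>"
    using w(1) by simp
  moreover have "y \<in> convex hull C"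
    unfolding x(2) using x(1) t C hull_inc[of a C convex] by (intro convexD) auto
  ultimately show "y \<in> {x \<in> convex hull C. t \<le> w \<bullet> x + \<beta>}"
    by simp
qed

lemma set_integral_homothety:
  fixes f :: "'b::euclidean_space \<Rightarrow> real"
  assumes "compact R" "continuous_on UNIV f" "0 < c"
  shows "(LINT x:(\<lambda>x. a + c *\<^sub>R x) ` R|lborel. f x) = c ^ DIM('b) * (LINT x:R|lborel. f (a + c *\<^sub>R x))"
proof -
  let ?h = "\<lambda>x. a + c *\<^sub>R x"
  have [measurable]: "f \<in> borel_measurable borel"
    using assms(2) borel_measurable_continuous_onI by blast
  have "compact (?h ` R)"
    by (intro compact_continuous_image continuous_intros assms)
  then have [measurable]: "?h ` R \<in> sets borel"
    by (simp add: borel_compact)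
  have ind: "indicator (?h ` R) (?h x) = (indicator R x :: real)" for x
    using assms(3) by (auto simp: indicator_def)
  have "(LINT x:?h ` R|lborel. f x) =
      (LINT x|density (distr lborel borel ?h) (\<lambda>_. \<bar>c\<bar>^DIM('b)). indicator (?h ` R) x * f x)"
    using lborel_affine[of c a] assms(3) by (simp add: set_lebesgue_integral_def)
  also have "\<dots> = (LINT x|distr lborel borel ?h. c ^ DIM('b) * (indicator (?h ` R) x * f x))"
    using assms(3) by (subst integral_density) auto
  also have "\<dots> = (LINT x|lborel. c ^ DIM('b) * (indicator (?h ` R) (?h x) * f (?h x)))"
    by (subst integral_distr) auto
  finally show ?thesis
    by (simp add: ind set_lebesgue_integral_def)
qed

text \<open>The superlevel sets of a barycentric coordinate are homothetic copies of the simplex, so the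
  layer cake formula reduces moments to moments of lower degree.\<close>

lemma integral_barycentric_layer_cake:
  fixes C :: "'b::euclidean_space set" and f :: "'b \<Rightarrow> real"
  assumes C: "finite C" "a \<in> C"
    and w: "w \<bullet> a + \<beta> = (1::real)" "\<And>c. c \<in> C \<Longrightarrow> c \<noteq> a \<Longrightarrow> w \<bullet> c + \<beta> = 0"
    and f: "continuous_on UNIV f"
    and F: "\<And>t. 0 \<le> t \<Longrightarrow> t < 1 \<Longrightarrow>
      (LINT x:convex hull C|lborel. f (t *\<^sub>R a + (1 - t) *\<^sub>R x)) = K * (1 - t) ^ k"
  shows "(LINT x:convex hull C|lborel. (w \<bullet> x + \<beta>) * f x) = K / (DIM('b) + k + 1)"
proof -
  let ?R = "convex hull C"
  let ?l = "\<lambda>x. w \<bullet> x + \<beta>"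
  \<comment> \<open>The region under the graph of the coordinate. Integrating \<open>f\<close> over
    it in the two orders yields the weighted integral on one side and the integrals over superlevel
    sets on the other.\<close>
  define S where "S = {p \<in> ?R \<times> {0..1}. snd p \<le> ?l (fst p)}"
  have cR: "compact ?R"
    using C by (simp add: finite_imp_compact_convex_hull)
  have l01: "0 \<le> ?l x \<and> ?l x \<le> 1" if x: "x \<in> ?R" for x
  proof -
    obtain u where u: "\<And>c. c \<in> C \<Longrightarrow> 0 \<le> u c" "sum u C = 1" "x = (\<Sum>c\<in>C. u c *\<^sub>R c)"
      using convex_hull_finite[OF C(1)] x by auto
    moreover have "u a \<le> 1"
      using member_le_sum[of a C u] u C by simp
    ultimately show ?thesis
      using barycentric_coordinate_eq[OF C u(2) w] C by simp
  qed
  have "compact S"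
  proof -
    have "S = (?R \<times> {0..1}) \<inter> {p. snd p \<le> ?l (fst p)}"
      by (auto simp: S_def)
    moreover have "closed {p :: 'b \<times> real. snd p \<le> ?l (fst p)}"
      by (intro closed_Collect_le continuous_intros)
    ultimately show ?thesis
      using cR by (simp add: compact_Int_closed compact_Times)
  qed
  have int: "integrable (lborel \<Otimes>\<^sub>M lborel) (\<lambda>p. indicator S p *\<^sub>R f (fst p))"
    unfolding lborel_prod
    by (intro borel_integrable_compact \<open>compact S\<close> continuous_on_compose2[OF f] continuous_intros) auto
  have "(LINT x|lborel. LINT t|lborel. indicator S (x, t) *\<^sub>R f x) =
      (LINT t|lborel. LINT x|lborel. indicator S (x, t) *\<^sub>R f x)"
    using lborel_pair.Fubini_integral[of "\<lambda>x t. indicator S (x, t) *\<^sub>R f x"] int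
    by (simp add: case_prod_unfold)
  moreover have "(LINT t|lborel. indicator S (x, t) *\<^sub>R f x) = indicator ?R x * (?l x * f x)" for x
  proof -
    have "(LINT t|lborel. indicator S (x, t) *\<^sub>R f x) =
        (LINT t|lborel. indicator {0..?l x} t * (indicator ?R x * f x))"
      using l01[of x] by (intro Bochner_Integration.integral_cong) (auto simp: S_def indicator_def)
    also have "\<dots> = measure lborel {0..?l x} * (indicator ?R x * f x)"
      by (subst integral_mult_left_zero) simp
    also have "\<dots> = indicator ?R x * (?l x * f x)"
      using l01[of x] by (cases "x \<in> ?R") auto
    finally show ?thesis .
  qed
  \<comment> \<open>At \<open>t = 1\<close> the homothety collapses to the point \<open>a\<close>,
    so this single null level is left out.\<close>
  moreover have "(LINT x|lborel. indicator S (x, t) *\<^sub>R f x) = K * ((1 - t) ^ (DIM('b) + k) * indicator {0..1} t)"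
    if "t \<noteq> 1" for t
  proof (cases "0 \<le> t \<and> t < 1")
    case True
    have "(LINT x|lborel. indicator S (x, t) *\<^sub>R f x) = (LINT x:{x \<in> ?R. t \<le> ?l x}|lborel. f x)"
      unfolding set_lebesgue_integral_def using True
      by (intro Bochner_Integration.integral_cong) (auto simp: S_def indicator_def)
    also have "\<dots> = (LINT x:(\<lambda>x. t *\<^sub>R a + (1 - t) *\<^sub>R x) ` ?R|lborel. f x)"
      using barycentric_superlevel_set[OF C w] True by simp
    also have "\<dots> = (1 - t) ^ DIM('b) * (LINT x:?R|lborel. f (t *\<^sub>R a + (1 - t) *\<^sub>R x))"
      using True by (intro set_integral_homothety cR f) auto
    finally show ?thesis
      using True F by (simp add: power_add)
  next
    case False
    then show ?thesis
      using that by (auto simp: S_def)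
  qed
  then have "(LINT t|lborel. LINT x|lborel. indicator S (x, t) *\<^sub>R f x) =
      (LINT t|lborel. K * ((1 - t) ^ (DIM('b) + k) * indicator {0..1} t))"
  proof (intro integral_cong_AE)
    show "AE t in lborel. (LINT x|lborel. indicator S (x, t) *\<^sub>R f x) = K * ((1 - t) ^ (DIM('b) + k) * indicator {0..1} t)"
      if *: "\<And>t. t \<noteq> 1 \<Longrightarrow> (LINT x|lborel. indicator S (x, t) *\<^sub>R f x) = K * ((1 - t) ^ (DIM('b) + k) * indicator {0..1} t)"
      using AE_lborel_singleton[of 1] by eventually_elim (rule *)
    show "(\<lambda>t. LINT x|lborel. indicator S (x, t) *\<^sub>R f x) \<in> borel_measurable lborel"
      using lborel_pair.integrable_snd[of "\<lambda>x t. indicator S (x, t) *\<^sub>R f x"] int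
      by (intro borel_measurable_integrable) (simp add: case_prod_unfold)
  qed auto
  \<comment> \<open>The exponent collects the Jacobian of the homothety and the degree
    \<open>k\<close> with which the integral of \<open>f\<close> scales.\<close>
  moreover have "(LINT t|lborel. ((1 - t) ^ (DIM('b) + k) * indicator {0..1} t)) = 1 / (DIM('b) + k + 1)"
  proof (subst integral_FTC_Icc_real[where F = "\<lambda>t. - ((1 - t) ^ Suc (DIM('b) + k) / Suc (DIM('b) + k))"])
    show "DERIV (\<lambda>t. - ((1 - t) ^ Suc (DIM('b) + k) / real (Suc (DIM('b) + k)))) x :> (1 - x) ^ (DIM('b) + k)" for x
      by (rule derivative_eq_intros refl | simp del: of_nat_Suc)+
  qed auto
  ultimately have "(LINT x|lborel. indicator ?R x * (?l x * f x)) = K * (1 / (DIM('b) + k + 1))"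
    by (simp only: integral_mult_right_zero)
  then show ?thesis
    by (simp add: set_lebesgue_integral_def)
qed

text \<open>Under the contraction towards \<open>a\<close> the coordinate of \<open>a\<close> itself
  does not scale by a pure power of \<open>1 - t\<close>, so the layer cake formula is applied only
  to constants and to the coordinates of other vertices. The square moments then follow from the
  partition of unity: the first moment of \<open>l a\<close> is the sum of all products
  \<open>l a * l b\<close>, of which \<open>n\<close> are mixed moments.\<close>

lemma simplex_moments:
  fixes C :: "'b::euclidean_space set"
  assumes C: "\<not> affine_dependent C" "card C = DIM('b) + 1"
  obtains l where "\<And>a. a \<in> C \<Longrightarrow> continuous_on UNIV (l a :: 'b \<Rightarrow> real)"
    and "\<And>x w \<beta>. x \<in> convex hull C \<Longrightarrow> w \<bullet> x + \<beta> = (\<Sum>a\<in>C. l a x * (w \<bullet> a + \<beta>))"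
    and "\<And>a b. a \<in> C \<Longrightarrow> b \<in> C \<Longrightarrow> (LINT x:convex hull C|lborel. l a x * l b x) =
      measure lborel (convex hull C) * (if a = b then 2 else 1) / (real DIM('b) + 1) / (real DIM('b) + 2)"
proof -
  let ?R = "convex hull C"
  let ?n = "DIM('b)"
  let ?m = "measure lborel ?R"
  have fin: "finite C"
    using C(1) aff_independent_finite by blast
  have "\<exists>w \<beta>. w \<bullet> a + \<beta> = (1::real) \<and> (\<forall>c\<in>C. c \<noteq> a \<longrightarrow> w \<bullet> c + \<beta> = 0)" if "a \<in> C" for a
    using barycentric_coordinate_exists[OF C(1) that] by metis
  then obtain W B where WB: "\<And>a. a \<in> C \<Longrightarrow> W a \<bullet> a + B a = (1::real)"
    "\<And>a c. a \<in> C \<Longrightarrow> c \<in> C \<Longrightarrow> c \<noteq> a \<Longrightarrow> W a \<bullet> c + B a = 0"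
    by metis
  define l where "l a x = W a \<bullet> x + B a" for a x
  have cont: "continuous_on S (l a)" for a S
    unfolding l_def by (intro continuous_intros)
  have cR: "compact ?R"
    using fin by (simp add: finite_imp_compact_convex_hull)
  have coord: "sum (\<lambda>a. l a x) C = 1 \<and> w \<bullet> x + \<beta> = (\<Sum>a\<in>C. l a x * (w \<bullet> a + \<beta>))"
    if "x \<in> ?R" for x w \<beta>
  proof -
    obtain u where u: "sum u C = 1" "x = (\<Sum>c\<in>C. u c *\<^sub>R c)"
      using convex_hull_finite[OF fin] \<open>x \<in> ?R\<close> by auto
    have "l a x = u a" if "a \<in> C" for a
      unfolding l_def u(2) using that by (intro barycentric_coordinate_eq fin u WB) auto
    then show ?thesis
      using u affine_sum_combination[OF u(1)] by simp
  qed
  have first: "(LINT x:?R|lborel. l a x) = ?m / (real ?n + 1)" if "a \<in> C" for a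
    using integral_barycentric_layer_cake[OF fin that WB(1)[OF that] WB(2)[OF that], of "\<lambda>_. 1" ?m 0]
    by (simp add: l_def set_lebesgue_integral_def measure_def)
  have mixed: "(LINT x:?R|lborel. l a x * l b x) = ?m / (real ?n + 1) / (real ?n + 2)"
    if "a \<in> C" "b \<in> C" "a \<noteq> b" for a b
  proof -
    have "l b (t *\<^sub>R a + (1 - t) *\<^sub>R x) = t * l b a + (1 - t) * l b x" for t x
      unfolding l_def by (simp add: inner_simps algebra_simps)
    moreover have "l b a = 0"
      using WB(2)[of b a] that by (simp add: l_def)
    \<comment> \<open>The coordinate of \<open>b\<close> vanishes at \<open>a\<close>, hence scales
      with degree \<open>k = 1\<close>; the constant \<open>K\<close> is its first moment.\<close>
    ultimately have "l b (t *\<^sub>R a + (1 - t) *\<^sub>R x) = (1 - t) * l b x" for t x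
      by simp
    then show ?thesis
      using integral_barycentric_layer_cake[OF fin that(1) WB(1)[OF that(1)] WB(2)[OF that(1)],
          of "l b" "?m / (real ?n + 1)" 1] first[OF that(2)] cont
      by (simp add: l_def[symmetric])
  qed
  have int: "set_integrable lborel ?R (\<lambda>x. l a x * l b x)" for a b
    unfolding set_integrable_def by (intro borel_integrable_compact cR continuous_intros cont)
  have square: "(LINT x:?R|lborel. l a x * l a x) = 2 * ?m / (real ?n + 1) / (real ?n + 2)" if a: "a \<in> C" for a
  proof -
    have "?m / (real ?n + 1) = (LINT x:?R|lborel. \<Sum>b\<in>C. l a x * l b x)"
      unfolding first[OF a, symmetric]
    proof (rule set_lebesgue_integral_cong)
      show "\<forall>x. x \<in> ?R \<longrightarrow> l a x = (\<Sum>b\<in>C. l a x * l b x)"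
        using coord by (simp flip: sum_distrib_left)
    qed (use cR in \<open>simp add: borel_compact\<close>)
    also have "\<dots> = (\<Sum>b\<in>C. LINT x:?R|lborel. l a x * l b x)"
      using int unfolding set_lebesgue_integral_def set_integrable_def
      by (simp add: sum_distrib_left Bochner_Integration.integral_sum)
    also have "\<dots> = (LINT x:?R|lborel. l a x * l a x) + (\<Sum>b\<in>C - {a}. LINT x:?R|lborel. l a x * l b x)"
      using fin a by (rule sum.remove)
    also have "(\<Sum>b\<in>C - {a}. LINT x:?R|lborel. l a x * l b x) = (\<Sum>b\<in>C - {a}. ?m / (real ?n + 1) / (real ?n + 2))"
      by (intro sum.cong refl mixed) (use a in auto)
    also have "(\<Sum>b\<in>C - {a}. ?m / (real ?n + 1) / (real ?n + 2)) = real ?n * (?m / (real ?n + 1) / (real ?n + 2))"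
      using C(2) a fin by simp
    finally have "(LINT x:?R|lborel. l a x * l a x) = ?m / (real ?n + 1) - real ?n * (?m / (real ?n + 1) / (real ?n + 2))"
      by linarith
    also have "\<dots> = 2 * ?m / (real ?n + 1) / (real ?n + 2)"
      by (simp add: divide_simps) (simp add: algebra_simps)
    finally show ?thesis .
  qed
  show thesis
  proof (rule that[of l])
    show "(LINT x:?R|lborel. l a x * l b x) =
        ?m * (if a = b then 2 else 1) / (real ?n + 1) / (real ?n + 2)" if "a \<in> C" "b \<in> C" for a b
      using square[of a] mixed[of a b] that by (cases "a = b") (auto simp: mult.commute)
  qed (use cont coord in auto)
qed

text \<open>Since \<open>\<theta> - \<eta> = 1 / s\<close>, each node value is
  \<open>f v / s\<close> plus a multiple of the full sum that is the same for all nodes. Products of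
  vertex values then get weight \<open>1 / (s * s)\<close>, which fixes
  \<open>s * s = n + 2\<close>. The weight of the product of sums comes out right through the
  factorization of \<open>1 - 1 / (s * s)\<close> into
  \<open>(1 - 1 / s) * (1 + 1 / s)\<close>.\<close>

lemma quadrature_sum_identity:
  fixes f g :: "'c \<Rightarrow> real" and n :: nat
  assumes C: "finite C" "card C = n + 1"
  defines "s \<equiv> sqrt (real n + 2)"
  defines "\<theta> \<equiv> (1 + real n / s) / (real n + 1)" and "\<eta> \<equiv> (1 - 1 / s) / (real n + 1)"
  shows "(\<Sum>v\<in>C. (\<theta> * f v + \<eta> * sum f (C - {v})) * (\<theta> * g v + \<eta> * sum g (C - {v}))) =
    (sum f C * sum g C + (\<Sum>v\<in>C. f v * g v)) / (real n + 2)"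
proof -
  have s: "s > 0" "s * s = real n + 2"
    by (auto simp: s_def)
  have \<theta>: "\<theta> = 1 / s + \<eta>"
    using s(1) by (simp add: \<theta>_def \<eta>_def divide_simps)
  have node: "\<theta> * h v + \<eta> * sum h (C - {v}) = h v / s + \<eta> * sum h C" if "v \<in> C" for h v
    using that C(1) by (simp add: \<theta> sum_diff1 algebra_simps)
  have "2 * \<eta> / s + (real n + 1) * (\<eta> * \<eta>) = \<eta> * (2 / s + (real n + 1) * \<eta>)"
    by (simp add: algebra_simps)
  also have "(real n + 1) * \<eta> = 1 - 1 / s"
    by (simp add: \<eta>_def)
  also have "\<eta> * (2 / s + (1 - 1 / s)) = (1 - 1 / (s * s)) / (real n + 1)"
    using s(1) by (simp add: \<eta>_def divide_simps) (simp add: algebra_simps)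
  also have "\<dots> = 1 / (real n + 2)"
    unfolding s(2) by (simp add: divide_simps)
  finally have \<eta>: "2 * \<eta> / s + (real n + 1) * (\<eta> * \<eta>) = 1 / (real n + 2)" .
  have "(\<Sum>v\<in>C. (\<theta> * f v + \<eta> * sum f (C - {v})) * (\<theta> * g v + \<eta> * sum g (C - {v}))) =
      (\<Sum>v\<in>C. f v * g v / (s * s) + \<eta> / s * sum g C * f v + \<eta> / s * sum f C * g v
        + \<eta> * \<eta> * (sum f C * sum g C))"
    using node by (intro sum.cong) (auto simp: algebra_simps)
  also have "\<dots> = (\<Sum>v\<in>C. f v * g v) / (s * s) +
      (2 * \<eta> / s + (real n + 1) * (\<eta> * \<eta>)) * (sum f C * sum g C)"
    unfolding sum.distrib sum_divide_distrib[symmetric] sum_distrib_left[symmetric] sum_constant C(2)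
    by (simp add: algebra_simps)
  also have "\<dots> = (sum f C * sum g C + (\<Sum>v\<in>C. f v * g v)) / (real n + 2)"
    unfolding \<eta> s(2) by (simp add: add_divide_distrib)
  finally show ?thesis .
qed

text \<open>Expanding both affine factors in barycentric coordinates leaves the second moments,
  whose sum is matched by \<open>quadrature_sum_identity\<close>. The location of the nodes follows
  from the positivity of \<open>\<theta>\<close> and \<open>\<eta>\<close>; it matters because the
  integrands of interest are controlled only inside the simplex.\<close>

lemma simplex_quadrature_exact:
  fixes R :: "'b::euclidean_space set"
  assumes R: "int DIM('b) simplex R"
  defines "s \<equiv> sqrt (real DIM('b) + 2)"
  defines "\<theta> \<equiv> (1 + real DIM('b) / s) / (real DIM('b) + 1)" and "\<eta> \<equiv> (1 - 1 / s) / (real DIM('b) + 1)"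
  defines "E \<equiv> {v. v extreme_point_of R}"
  defines "\<zeta> \<equiv> \<lambda>v. \<theta> *\<^sub>R v + \<eta> *\<^sub>R (\<Sum>w\<in>E - {v}. w)"
  shows "(LINT x:R|lborel. (p \<bullet> x + \<alpha>) * (q \<bullet> x + \<beta>)) =
      (\<Sum>v\<in>E. measure lborel R / (real DIM('b) + 1) * ((p \<bullet> \<zeta> v + \<alpha>) * (q \<bullet> \<zeta> v + \<beta>)))"
    and "v extreme_point_of R \<Longrightarrow> \<zeta> v \<in> interior R"
proof -
  let ?n = "DIM('b)"
  obtain C where C: "\<not> affine_dependent C" "card C = ?n + 1" "R = convex hull C"
    using R unfolding simplex_def by auto
  have fin: "finite C"
    using C(1) aff_independent_finite by blast
  have E: "E = C"
    using extreme_point_of_convex_hull_affine_independent[OF C(1)] C(3) by (auto simp: E_def)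
  have s: "1 < s"
    by (simp add: s_def)
  have pos: "0 < \<theta>" "0 < \<eta>"
    using s by (auto simp: \<theta>_def \<eta>_def intro!: divide_pos_pos add_pos_nonneg)
  have one: "\<theta> + real ?n * \<eta> = 1"
    using s by (simp add: \<theta>_def \<eta>_def divide_simps) (simp add: algebra_simps)
  define u where "u v c = (if c = v then \<theta> else \<eta>)" for v c :: 'b
  have u1: "sum (u v) C = 1" if "v \<in> C" for v
  proof -
    have "sum (u v) C = \<theta> + sum (u v) (C - {v})"
      using fin that by (simp add: sum.remove[of _ v] u_def)
    also have "sum (u v) (C - {v}) = (\<Sum>c\<in>C - {v}. \<eta>)"
      by (intro sum.cong) (auto simp: u_def)
    finally show ?thesis
      using C(2) fin that one by simp
  qed
  have \<zeta>: "\<zeta> v = (\<Sum>c\<in>C. u v c *\<^sub>R c)" if "v \<in> C" for v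
  proof -
    have "(\<Sum>c\<in>C. u v c *\<^sub>R c) = \<theta> *\<^sub>R v + (\<Sum>c\<in>C - {v}. u v c *\<^sub>R c)"
      using fin that by (simp add: sum.remove[of _ v] u_def)
    also have "(\<Sum>c\<in>C - {v}. u v c *\<^sub>R c) = (\<Sum>c\<in>C - {v}. \<eta> *\<^sub>R c)"
      by (intro sum.cong) (auto simp: u_def)
    finally show ?thesis
      by (simp add: \<zeta>_def E scaleR_sum_right)
  qed
  show "\<zeta> v \<in> interior R" if "v extreme_point_of R"
  proof -
    have v: "v \<in> C"
      using that E E_def by auto
    have "\<zeta> v \<in> rel_interior R"
      unfolding C(3) rel_interior_convex_hull_explicit[OF C(1)]
      using \<zeta>[OF v] u1[OF v] pos by (auto simp: u_def intro!: exI[of _ "u v"])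
    moreover have "affine hull R = UNIV"
      unfolding C(3) affine_hull_convex_hull by (rule affine_independent_span_eq[OF C(1)]) (simp add: C(2))
    ultimately show ?thesis
      using rel_interior_interior by auto
  qed
  obtain l where l: "\<And>a. a \<in> C \<Longrightarrow> continuous_on UNIV (l a :: 'b \<Rightarrow> real)"
    "\<And>x w \<beta>. x \<in> R \<Longrightarrow> w \<bullet> x + \<beta> = (\<Sum>a\<in>C. l a x * (w \<bullet> a + \<beta>))"
    "\<And>a b. a \<in> C \<Longrightarrow> b \<in> C \<Longrightarrow> (LINT x:R|lborel. l a x * l b x) =
      measure lborel R * (if a = b then 2 else 1) / (real ?n + 1) / (real ?n + 2)"
    by (rule simplex_moments[OF C(1,2), folded C(3)], rule that)
  have cR: "compact R"
    using compact_simplex R by blast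
  let ?f = "\<lambda>v. p \<bullet> v + \<alpha>" and ?g = "\<lambda>v. q \<bullet> v + \<beta>"
  have "(LINT x:R|lborel. ?f x * ?g x) =
      (LINT x:R|lborel. \<Sum>a\<in>C. \<Sum>b\<in>C. (?f a * ?g b) * (l a x * l b x))"
  proof (rule set_lebesgue_integral_cong)
    show "\<forall>x. x \<in> R \<longrightarrow> ?f x * ?g x = (\<Sum>a\<in>C. \<Sum>b\<in>C. (?f a * ?g b) * (l a x * l b x))"
    proof (intro allI impI)
      fix x assume x: "x \<in> R"
      show "?f x * ?g x = (\<Sum>a\<in>C. \<Sum>b\<in>C. (?f a * ?g b) * (l a x * l b x))"
        unfolding l(2)[OF x, of p] l(2)[OF x, of q] sum_product by (simp add: mult_ac)
    qed
  qed (use cR in \<open>simp add: borel_compact\<close>)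
  also have "\<dots> = (\<Sum>a\<in>C. \<Sum>b\<in>C. (?f a * ?g b) * (LINT x:R|lborel. l a x * l b x))"
  proof -
    have int: "integrable lborel (\<lambda>x. indicator R x * (l a x * l b x))" if "a \<in> C" "b \<in> C" for a b
      using borel_integrable_compact[OF cR, of "\<lambda>x. l a x * l b x"]
        continuous_on_subset[OF l(1)] that by (auto intro!: continuous_intros)
    have "(LINT x:R|lborel. \<Sum>a\<in>C. \<Sum>b\<in>C. (?f a * ?g b) * (l a x * l b x)) =
        (LINT x|lborel. (\<Sum>a\<in>C. \<Sum>b\<in>C. (?f a * ?g b) * (indicator R x * (l a x * l b x))))"
      unfolding set_lebesgue_integral_def real_scaleR_def sum_distrib_left by (simp only: mult_ac)
    also have "\<dots> = (\<Sum>a\<in>C. \<Sum>b\<in>C. (?f a * ?g b) * (LINT x:R|lborel. l a x * l b x))"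
      unfolding set_lebesgue_integral_def
      by (simp add: Bochner_Integration.integral_sum int)
    finally show ?thesis .
  qed
  also have "\<dots> = (\<Sum>a\<in>C. \<Sum>b\<in>C. measure lborel R / (real ?n + 1) / (real ?n + 2) *
      (?f a * ?g b + (if a = b then ?f a * ?g b else 0)))"
    by (intro sum.cong refl) (auto simp: l(3))
  also have "\<dots> = measure lborel R / (real ?n + 1) * ((sum ?f C * sum ?g C + (\<Sum>v\<in>C. ?f v * ?g v)) / (real ?n + 2))"
  proof -
    have "(\<Sum>a\<in>C. \<Sum>b\<in>C. k * (F a * G b + (if a = b then F a * G b else 0))) =
        k * (sum F C * sum G C + (\<Sum>v\<in>C. F v * G v))" for k :: real and F G
      using fin by (simp add: sum.distrib sum_product flip: sum_distrib_left)
    then show ?thesis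
      by (simp only:) simp
  qed
  also have "(sum ?f C * sum ?g C + (\<Sum>v\<in>C. ?f v * ?g v)) / (real ?n + 2) =
      (\<Sum>v\<in>C. (\<theta> * ?f v + \<eta> * sum ?f (C - {v})) * (\<theta> * ?g v + \<eta> * sum ?g (C - {v})))"
    using quadrature_sum_identity[OF fin C(2), of ?f ?g]
    by (simp add: \<theta>_def \<eta>_def s_def)
  also have "\<dots> = (\<Sum>v\<in>C. (p \<bullet> \<zeta> v + \<alpha>) * (q \<bullet> \<zeta> v + \<beta>))"
  proof (intro sum.cong refl)
    fix v assume v: "v \<in> C"
    have "w \<bullet> \<zeta> v + \<gamma> = \<theta> * (w \<bullet> v + \<gamma>) + \<eta> * (\<Sum>c\<in>C - {v}. w \<bullet> c + \<gamma>)" for w \<gamma>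
    proof -
      have "w \<bullet> \<zeta> v + \<gamma> = (\<Sum>c\<in>C. u v c * (w \<bullet> c + \<gamma>))"
        unfolding \<zeta>[OF v] by (rule affine_sum_combination[OF u1[OF v]])
      also have "\<dots> = \<theta> * (w \<bullet> v + \<gamma>) + (\<Sum>c\<in>C - {v}. u v c * (w \<bullet> c + \<gamma>))"
        using fin v by (simp add: sum.remove[of _ v] u_def)
      also have "(\<Sum>c\<in>C - {v}. u v c * (w \<bullet> c + \<gamma>)) = \<eta> * (\<Sum>c\<in>C - {v}. w \<bullet> c + \<gamma>)"
        unfolding sum_distrib_left by (intro sum.cong) (auto simp: u_def)
      finally show ?thesis .
    qed
    then show "(\<theta> * ?f v + \<eta> * sum ?f (C - {v})) * (\<theta> * ?g v + \<eta> * sum ?g (C - {v})) =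
        (p \<bullet> \<zeta> v + \<alpha>) * (q \<bullet> \<zeta> v + \<beta>)"
      by simp
  qed
  finally show "(LINT x:R|lborel. ?f x * ?g x) =
      (\<Sum>v\<in>E. measure lborel R / (real ?n + 1) * ((p \<bullet> \<zeta> v + \<alpha>) * (q \<bullet> \<zeta> v + \<beta>)))"
    by (simp add: E sum_distrib_left)
qed

section \<open>The averaged kernel\<close>

text \<open>Extending by 0 to a box symmetric about the origin reduces the claim to reflection of a
  box.\<close>

lemma integral_reflect_bounded:
  fixes f :: "'a::euclidean_space \<Rightarrow> real"
  assumes "bounded S"
  shows "integral (uminus ` S) f = integral S (\<lambda>x. f (- x))"
proof -
  obtain a where a: "S \<subseteq> cbox (- a) a"
    using bounded_subset_cbox_symmetric[OF assms] by blast
  then have a': "uminus ` S \<subseteq> cbox (- a) a"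
    by (force simp: mem_box)
  have "integral (uminus ` S) f = integral (cbox (- a) a) (\<lambda>x. if x \<in> uminus ` S then f x else 0)"
    using a' by (simp add: Henstock_Kurzweil_Integration.integral_restrict_Int Int_absorb2)
  also have "\<dots> = integral (cbox (- a) (- (- a))) (\<lambda>x. if - x \<in> uminus ` S then f (- x) else 0)"
    using integral_reflect[of a "- a" "\<lambda>x. if x \<in> uminus ` S then f x else 0"] by simp
  also have "\<dots> = integral (cbox (- a) a) (\<lambda>x. if x \<in> S then f (- x) else 0)"
    by (simp add: image_iff)
  also have "\<dots> = integral S (\<lambda>x. f (- x))"
    using a by (simp add: Henstock_Kurzweil_Integration.integral_restrict_Int Int_absorb2)
  finally show ?thesis .
qed

text \<open>A nonempty open set is not negligible, so null overlap becomes genuine disjointness.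
  This serves both the kernel cells and the quadrature simplices.\<close>

lemma interior_Int_interior_empty:
  assumes "negligible (S \<inter> T)"
  shows "interior S \<inter> interior T = {}"
proof -
  have "negligible (interior S \<inter> interior T)"
    using assms by (rule negligible_subset) (use interior_subset in blast)
  then show ?thesis
    using open_not_negligible[of "interior S \<inter> interior T"] by blast
qed

lemma AE_lebesgue_negligible:
  assumes "AE x in lebesgue. P x"
  obtains N where "negligible N" "\<And>x. x \<notin> N \<Longrightarrow> P x"
proof -
  obtain N where "N \<in> null_sets lebesgue" "{x. \<not> P x} \<subseteq> N"
    using assms by (auto simp: eventually_ae_filter)
  then show thesis
    by (intro that[of N]) (auto simp: negligible_iff_null_sets)
qed

locale symmetric_kernel_partition =
  fixes \<rho> :: "'a::euclidean_space \<Rightarrow> real" and P :: "'a set" and \<Z> :: "'a set set"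
  assumes kernel_integrable: "set_integrable lebesgue (ball 0 1) \<rho>"
    and kernel_even: "AE z in lebesgue. z \<in> ball 0 1 \<longrightarrow> \<rho> (- z) = \<rho> z"
    and kernel_nonneg: "AE z in lebesgue. z \<in> ball 0 1 \<longrightarrow> 0 \<le> \<rho> z"
    and P: "uminus ` P = P" "ball 0 (1/2) \<subseteq> P" "P \<subseteq> cball 0 1"
    and partition: "polytopal_partition P \<Z>"
    and symmetric: "\<forall>Z\<in>\<Z>. uminus ` Z \<in> \<Z>"
begin

abbreviation "\<kappa> \<equiv> averaged_kernel \<rho> \<Z>"

lemma
  shows finite_cells: "finite \<Z>"
    and Union_cells: "\<Union>\<Z> = P"
    and cell_pos: "Z \<in> \<Z> \<Longrightarrow> 0 < measure lebesgue Z"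
    and cell_compact: "Z \<in> \<Z> \<Longrightarrow> compact Z"
    and cell_convex: "Z \<in> \<Z> \<Longrightarrow> convex Z"
    and cell_overlap: "Z \<in> \<Z> \<Longrightarrow> Z' \<in> \<Z> \<Longrightarrow> Z \<noteq> Z' \<Longrightarrow> negligible (Z \<inter> Z')"
  using partition polytope_imp_compact polytope_imp_convex
  unfolding polytopal_partition_def pairwise_def by auto

lemma interior_cells_disjoint:
  "Z \<in> \<Z> \<Longrightarrow> Z' \<in> \<Z> \<Longrightarrow> Z \<noteq> Z' \<Longrightarrow> interior Z \<inter> interior Z' = {}"
  using cell_overlap interior_Int_interior_empty by blast

lemma averaged_kernel_interior:
  assumes "Z \<in> \<Z>" "z \<in> interior Z"
  shows "\<kappa> z = cell_average \<rho> Z"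
proof -
  have "\<kappa> z = (\<Sum>Z'\<in>\<Z>. if Z' = Z then cell_average \<rho> Z else 0)"
    unfolding averaged_kernel_def
  proof (intro sum.cong refl)
    fix Z' assume "Z' \<in> \<Z>"
    then show "cell_average \<rho> Z' * indicator (interior Z') z = (if Z' = Z then cell_average \<rho> Z else 0)"
      using interior_cells_disjoint[of Z' Z] assms by (auto simp: indicator_def)
  qed
  then show ?thesis
    using assms finite_cells by simp
qed

lemma cell_integrable:
  assumes "Z \<in> \<Z>"
  shows "set_integrable lebesgue (Z \<inter> ball 0 1) \<rho>"
  using cell_compact[OF assms]
  by (intro set_integrable_subset[OF kernel_integrable]) (auto simp: lmeasurable_compact fmeasurableD)

lemma cell_mass_nonneg:
  assumes "Z \<in> \<Z>"
  shows "0 \<le> cell_mass \<rho> Z"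
  unfolding cell_mass_def set_lebesgue_integral_def
  using kernel_nonneg by (intro integral_nonneg_AE) (auto simp: indicator_def)

lemma cell_average_nonneg: "Z \<in> \<Z> \<Longrightarrow> 0 \<le> cell_average \<rho> Z"
  unfolding cell_average_def using cell_mass_nonneg by simp

lemma averaged_kernel_nonneg: "0 \<le> \<kappa> z"
  unfolding averaged_kernel_def by (intro sum_nonneg mult_nonneg_nonneg cell_average_nonneg) auto

lemma cell_average_reflect:
  assumes "Z \<in> \<Z>"
  shows "cell_average \<rho> (uminus ` Z) = cell_average \<rho> Z"
proof -
  have Z': "uminus ` Z \<in> \<Z>"
    using symmetric assms by blast
  have bdd: "bounded Z"
    using cell_compact[OF assms] compact_imp_bounded by blast
  have "measure lebesgue (uminus ` Z) = measure lebesgue Z"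
    using integral_reflect_bounded[OF bdd, of "\<lambda>_. 1"] lmeasure_integral
      lmeasurable_compact[OF cell_compact] assms Z' by metis
  moreover have "cell_mass \<rho> (uminus ` Z) = cell_mass \<rho> Z"
  proof -
    obtain N where N: "negligible N" "\<And>z. z \<notin> N \<Longrightarrow> z \<in> ball 0 1 \<Longrightarrow> \<rho> (- z) = \<rho> z"
      using kernel_even by (rule AE_lebesgue_negligible) blast
    have *: "uminus ` Z \<inter> ball 0 1 = uminus ` (Z \<inter> ball 0 1)"
      by (auto simp: image_iff)
    have "cell_mass \<rho> (uminus ` Z) = integral (uminus ` (Z \<inter> ball 0 1)) \<rho>"
      unfolding cell_mass_def using set_lebesgue_integral_eq_integral(2)[OF cell_integrable[OF Z']]
      by (simp add: *)
    also have "\<dots> = integral (Z \<inter> ball 0 1) (\<lambda>x. \<rho> (- x))"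
      by (intro integral_reflect_bounded) (simp add: bdd bounded_Int)
    also have "\<dots> = integral (Z \<inter> ball 0 1) \<rho>"
      by (rule integral_spike[OF N(1)]) (use N(2) in auto)
    also have "\<dots> = cell_mass \<rho> Z"
      unfolding cell_mass_def using set_lebesgue_integral_eq_integral(2)[OF cell_integrable[OF assms]]
      by simp
    finally show ?thesis .
  qed
  ultimately show ?thesis
    by (simp add: cell_average_def)
qed

text \<open>Reflection permutes the cells, so the sum may be reindexed. Evenness of
  \<open>\<rho>\<close> enters only through integrals, which is why an almost everywhere hypothesis
  gives a pointwise conclusion.\<close>

lemma averaged_kernel_even: "\<kappa> (- z) = \<kappa> z"
proof -
  have "inj_on ((`) uminus) \<Z>"
    by (auto intro!: inj_onI simp: inj_image_eq_iff)
  moreover have "(`) uminus ` \<Z> = \<Z>"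
  proof (intro equalityI subsetI)
    fix Z assume "Z \<in> \<Z>"
    moreover have "Z = uminus ` uminus ` Z"
      by (simp add: image_image)
    ultimately show "Z \<in> (`) uminus ` \<Z>"
      using symmetric by blast
  qed (use symmetric in auto)
  ultimately have "\<kappa> (- z) = (\<Sum>Z\<in>\<Z>. cell_average \<rho> (uminus ` Z) * indicator (interior (uminus ` Z)) (- z))"
    unfolding averaged_kernel_def
    using sum.reindex[of "(`) uminus" \<Z> "\<lambda>Z. cell_average \<rho> Z * indicator (interior Z) (- z)"] by simp
  also have "\<dots> = \<kappa> z"
    unfolding averaged_kernel_def
    by (intro sum.cong refl) (auto simp: cell_average_reflect interior_negations indicator_def)
  finally show ?thesis .
qed

lemma averaged_kernel_set_integrable: "set_integrable lebesgue (ball 0 1) \<kappa>"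
proof -
  have "set_integrable lebesgue (ball 0 1) (\<lambda>z. cell_average \<rho> Z * indicator (interior Z) z)" if "Z \<in> \<Z>" for Z
  proof -
    have "ball 0 1 \<inter> interior Z \<in> lmeasurable"
      by (intro lmeasurable_open bounded_Int) (auto simp: open_Int)
    then have "integrable lebesgue (\<lambda>z. cell_average \<rho> Z * indicator (ball 0 1 \<inter> interior Z) z)"
      by (simp add: lmeasurable_iff_integrable)
    moreover have "(\<lambda>z. cell_average \<rho> Z * indicator (ball 0 1 \<inter> interior Z) z) =
      (\<lambda>z. indicator (ball 0 1) z *\<^sub>R (cell_average \<rho> Z * indicator (interior Z) z))"
      by (auto simp: indicator_def)
    ultimately show ?thesis
      unfolding set_integrable_def by metis
  qed
  then show ?thesis
    unfolding averaged_kernel_def set_integrable_def scaleR_sum_right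
    by (intro Bochner_Integration.integrable_sum)
qed

text \<open>Average times volume is the mass of \<open>\<rho>\<close> on a cell, so averaging adds
  no mass there. As overlaps are null, the cell masses add up to the integral of
  \<open>\<rho>\<close> over the covered part of the unit ball.\<close>

lemma averaged_kernel_L1_le: "(LINT z:ball 0 1|lebesgue. \<bar>\<kappa> z\<bar>) \<le> (LINT z:ball 0 1|lebesgue. \<bar>\<rho> z\<bar>)"
proof -
  have "(LINT z:ball 0 1|lebesgue. \<bar>\<kappa> z\<bar>) =
      (LINT z|lebesgue. (\<Sum>Z\<in>\<Z>. cell_average \<rho> Z * indicator (ball 0 1 \<inter> interior Z) z))"
    unfolding set_lebesgue_integral_def
    by (intro Bochner_Integration.integral_cong refl)
       (auto simp: averaged_kernel_nonneg, auto simp: averaged_kernel_def indicator_def intro!: sum.cong)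
  also have "\<dots> = (\<Sum>Z\<in>\<Z>. cell_average \<rho> Z * measure lebesgue (ball 0 1 \<inter> interior Z))"
  proof -
    have "ball 0 1 \<inter> interior Z \<in> lmeasurable" for Z :: "'a set"
      by (intro lmeasurable_open bounded_Int) (auto simp: open_Int)
    then have "integrable lebesgue (\<lambda>z. cell_average \<rho> Z * indicator (ball 0 1 \<inter> interior Z) z)" for Z
      by (simp add: lmeasurable_iff_integrable)
    then show ?thesis
      by (subst Bochner_Integration.integral_sum) auto
  qed
  also have "\<dots> \<le> (\<Sum>Z\<in>\<Z>. cell_mass \<rho> Z)"
  proof (intro sum_mono)
    fix Z assume Z: "Z \<in> \<Z>"
    have "measure lebesgue (ball 0 1 \<inter> interior Z) \<le> measure lebesgue Z"
      using lmeasurable_compact[OF cell_compact[OF Z]] interior_subset[of Z]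
      by (intro measure_mono_fmeasurable) auto
    then have "cell_average \<rho> Z * measure lebesgue (ball 0 1 \<inter> interior Z) \<le> cell_average \<rho> Z * measure lebesgue Z"
      using cell_average_nonneg[OF Z] mult_left_mono by blast
    then show "cell_average \<rho> Z * measure lebesgue (ball 0 1 \<inter> interior Z) \<le> cell_mass \<rho> Z"
      using cell_pos[OF Z] by (simp add: cell_average_def)
  qed
  also have "\<dots> = (LINT z:(\<Union>Z\<in>\<Z>. Z \<inter> ball 0 1)|lebesgue. \<rho> z)"
    unfolding cell_mass_def
  proof (rule set_integral_finite_UN_AE[symmetric])
    show "AE x in lebesgue. x \<in> Z \<inter> ball 0 1 \<and> x \<in> Z' \<inter> ball 0 1 \<longrightarrow> Z = Z'"
      if "Z \<in> \<Z>" "Z' \<in> \<Z>" for Z Z'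
    proof (cases "Z = Z'")
      case False
      then have "Z \<inter> Z' \<in> null_sets lebesgue"
        using cell_overlap that by (simp add: negligible_iff_null_sets)
      then show ?thesis
        by (rule AE_I') (use False in auto)
    qed auto
    show "Z \<inter> ball 0 1 \<in> sets lebesgue" if "Z \<in> \<Z>" for Z
      using lmeasurable_compact[OF cell_compact[OF that]] by auto
  qed (auto simp: finite_cells cell_integrable)
  also have "\<dots> \<le> (LINT z:ball 0 1|lebesgue. \<bar>\<rho> z\<bar>)"
    unfolding set_lebesgue_integral_def
  proof (rule integral_mono)
    have "set_integrable lebesgue (\<Union>Z\<in>\<Z>. Z \<inter> ball 0 1) \<rho>"
      using lmeasurable_compact[OF cell_compact] finite_cells
      by (intro set_integrable_subset[OF kernel_integrable] sets.finite_UN) auto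
    then show "integrable lebesgue (\<lambda>z. indicator (\<Union>Z\<in>\<Z>. Z \<inter> ball 0 1) z *\<^sub>R \<rho> z)"
      by (simp add: set_integrable_def)
    show "integrable lebesgue (\<lambda>z. indicator (ball 0 1) z *\<^sub>R \<bar>\<rho> z\<bar>)"
      using set_integrable_abs[OF kernel_integrable] by (simp add: set_integrable_def)
  qed (auto simp: indicator_def)
  finally show ?thesis .
qed

lemma cell_average_lower_bound:
  assumes Z: "Z \<in> \<Z>" "Z \<subseteq> ball 0 r" and r: "r \<le> 1"
    and low: "AE z in lebesgue. z \<in> ball 0 r \<longrightarrow> c \<le> \<rho> z"
  shows "c \<le> cell_average \<rho> Z"
proof -
  have ZZ: "Z \<inter> ball 0 1 = Z"
    using Z r by auto
  have lm: "Z \<in> lmeasurable"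
    using lmeasurable_compact cell_compact Z by blast
  have "c * measure lebesgue Z = (LINT z|lebesgue. c * indicator Z z)"
    using lm by simp
  also have "\<dots> \<le> (LINT z|lebesgue. indicator Z z *\<^sub>R \<rho> z)"
  proof (rule integral_mono_AE)
    show "AE z in lebesgue. c * indicator Z z \<le> indicator Z z *\<^sub>R \<rho> z"
      using low by eventually_elim (use Z in \<open>auto simp: indicator_def\<close>)
    show "integrable lebesgue (\<lambda>z. c * indicator Z z)"
      using lm by (simp add: lmeasurable_iff_integrable)
    show "integrable lebesgue (\<lambda>z. indicator Z z *\<^sub>R \<rho> z)"
      using cell_integrable[OF Z(1)] by (simp add: ZZ set_integrable_def)
  qed
  also have "\<dots> = cell_mass \<rho> Z"
    by (simp add: cell_mass_def ZZ set_lebesgue_integral_def)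
  finally show ?thesis
    using cell_pos[OF Z(1)] by (simp add: cell_average_def pos_le_divide_eq)
qed

text \<open>The pointwise form on cell interiors is what definiteness uses, since there the bound
  has to hold on an open set of relative positions; the almost everywhere bound also follows from
  it.\<close>

lemma averaged_kernel_lower_bound_interior:
  assumes z: "Z \<in> \<Z>" "z \<in> interior Z" "z \<in> ball 0 (r / 2)"
    and r: "0 < r" "r \<le> 1" "Max (diameter ` \<Z>) \<le> r / 2"
    and low: "AE z in lebesgue. z \<in> ball 0 r \<longrightarrow> c \<le> \<rho> z"
  shows "c \<le> \<kappa> z"
proof -
  have "Z \<subseteq> ball 0 r"
  proof
    fix x assume x: "x \<in> Z"
    have "dist x z \<le> diameter Z"
      using diameter_bounded_bound[of Z x z] cell_compact[OF z(1)] compact_imp_bounded x z(2)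
        interior_subset by blast
    also have "diameter Z \<le> Max (diameter ` \<Z>)"
      using finite_cells z(1) by simp
    also note r(3)
    finally have "dist x z \<le> r / 2" .
    moreover have "norm z < r / 2"
      using z(3) by simp
    ultimately show "x \<in> ball 0 r"
      using norm_triangle_ineq[of "x - z" z] by (simp add: dist_norm)
  qed
  then show ?thesis
    using cell_average_lower_bound[OF z(1) _ r(2) low] averaged_kernel_interior[OF z(1,2)] by simp
qed

lemma negligible_outside_cells: "negligible (P - (\<Union>Z\<in>\<Z>. interior Z))"
proof (rule negligible_subset)
  show "negligible (\<Union>Z\<in>\<Z>. frontier Z)"
    using finite_cells negligible_convex_frontier cell_convex by (intro negligible_Union) auto
  show "P - (\<Union>Z\<in>\<Z>. interior Z) \<subseteq> (\<Union>Z\<in>\<Z>. frontier Z)"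
    using Union_cells closure_subset by (fastforce simp: frontier_def)
qed

lemma averaged_kernel_lower_bound:
  assumes r: "0 < r" "r \<le> 1" "Max (diameter ` \<Z>) \<le> r / 2"
    and low: "AE z in lebesgue. z \<in> ball 0 r \<longrightarrow> c \<le> \<rho> z"
  shows "AE z in lebesgue. z \<in> ball 0 (r / 2) \<longrightarrow> c \<le> \<kappa> z"
proof (rule AE_I')
  show "P - (\<Union>Z\<in>\<Z>. interior Z) \<in> null_sets lebesgue"
    using negligible_outside_cells by (simp add: negligible_iff_null_sets)
  \<comment> \<open>Because of this inclusion, extending the kernel by zero outside \<open>P\<close>
    cannot spoil the lower bound: the only exceptional points are those of \<open>P\<close> interior
    to no cell.\<close>
  have "ball 0 (r / 2) \<subseteq> P"
    using P(2) r(2) subset_ball[of "r / 2" "1 / 2" "0 :: 'a"] by auto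
  then show "{z \<in> space lebesgue. \<not> (z \<in> ball 0 (r / 2) \<longrightarrow> c \<le> \<kappa> z)} \<subseteq> P - (\<Union>Z\<in>\<Z>. interior Z)"
    using averaged_kernel_lower_bound_interior[OF _ _ _ r low] by auto
qed

end

section \<open>The nonlocal form\<close>

text \<open>The property fails for a slit domain, which lies on both sides of its boundary. A local
  epigraph excludes this: the strict hypograph \<open>V\<close> is open and misses
  \<open>\<Omega>\<close>, hence also its closure, yet it comes arbitrarily close to each boundary
  point.\<close>

lemma interior_closure_lipschitz:
  fixes \<Omega> :: "'a::euclidean_space set"
  assumes "open \<Omega>" "lipschitz_boundary \<Omega>"
  shows "interior (closure \<Omega>) = \<Omega>"
proof (rule ccontr)
  assume "interior (closure \<Omega>) \<noteq> \<Omega>"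
  moreover have "\<Omega> \<subseteq> interior (closure \<Omega>)"
    using assms(1) by (simp add: interior_maximal closure_subset)
  ultimately obtain x where x: "x \<in> interior (closure \<Omega>)" "x \<notin> \<Omega>"
    by blast
  then have "x \<in> frontier \<Omega>"
    using assms(1) interior_subset by (auto simp: frontier_def interior_open)
  then obtain U e \<gamma> L where U: "open U" "x \<in> U" and e: "norm e = 1"
    and L: "L-lipschitz_on {w. w \<bullet> e = 0} (\<gamma> :: 'a \<Rightarrow> real)"
    and epi: "\<Omega> \<inter> U = {y \<in> U. \<gamma> (y - (y \<bullet> e) *\<^sub>R e) < y \<bullet> e}"
    using assms(2) unfolding lipschitz_boundary_def by (elim ballE exE conjE) (rule that; simp?)+
  have ee: "e \<bullet> e = 1"
    using e by (simp add: dot_square_norm)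
  let ?\<pi> = "\<lambda>y. y - (y \<bullet> e) *\<^sub>R e"
  have cont: "continuous_on UNIV (\<lambda>y. \<gamma> (?\<pi> y))"
    by (rule continuous_on_compose2[OF lipschitz_on_continuous_on[OF L]])
       (auto intro!: continuous_intros simp: inner_diff_left ee)
  define V where "V = U \<inter> {y. y \<bullet> e < \<gamma> (?\<pi> y)}"
  have "open V"
    unfolding V_def using U(1) by (intro open_Int open_Collect_less cont continuous_intros) auto
  moreover have "V \<inter> \<Omega> = {}"
  proof -
    have "\<gamma> (?\<pi> y) < y \<bullet> e" if "y \<in> \<Omega> \<inter> U" for y
      using that unfolding epi by simp
    then show ?thesis
      unfolding V_def by fastforce
  qed
  ultimately have V: "V \<inter> closure \<Omega> = {}"
    using open_Int_closure_eq_empty by blast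
  obtain r where r: "r > 0" "ball x r \<subseteq> U \<inter> interior (closure \<Omega>)"
    using openE[of "U \<inter> interior (closure \<Omega>)" x] U x(1) by auto
  \<comment> \<open>Moving against \<open>e\<close> leaves the projection unchanged, so
    \<open>y\<close> drops strictly below the graph while staying within the ball.\<close>
  define y where "y = x - (r / 2) *\<^sub>R e"
  have "dist x y < r"
    using r e by (simp add: y_def dist_norm)
  then have y: "y \<in> U" "y \<in> closure \<Omega>"
    using r interior_subset by (auto simp: subset_iff)
  have "?\<pi> y = ?\<pi> x"
    by (simp add: y_def inner_diff_left ee algebra_simps)
  moreover have "x \<bullet> e \<le> \<gamma> (?\<pi> x)"
    using epi U(2) x(2) by force
  moreover have "y \<bullet> e < x \<bullet> e"
    using r(1) by (simp add: y_def inner_diff_left ee)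
  ultimately have "y \<in> V"
    using y(1) by (simp add: V_def)
  then show False
    using V y(2) by blast
qed

text \<open>A point of \<open>\<Omega>\<close> reaches its partner by a step in
  \<open>\<delta> P\<close>, directly or, in the opposite direction, by the symmetry of
  \<open>P\<close>. Membership of both points in the extended domain is therefore automatic.\<close>

lemma interaction_pairs_eq:
  fixes \<Omega> :: "'a::euclidean_space set"
  assumes "0 \<in> P" "uminus ` P = P"
  shows "interaction_pairs \<Omega> P \<delta> = {(x, y). (x \<in> \<Omega> \<or> y \<in> \<Omega>) \<and> y - x \<in> (*\<^sub>R) \<delta> ` P}"
proof -
  have "x \<in> extended_domain \<Omega> P \<delta> \<and> y \<in> extended_domain \<Omega> P \<delta>"
    if xy: "x \<in> \<Omega> \<or> y \<in> \<Omega>" "y - x = \<delta> *\<^sub>R p" "p \<in> P" for x y p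
  proof -
    have mp: "- p \<in> P"
      using assms(2) xy(3) by blast
    have "y = x + \<delta> *\<^sub>R p" "x = y + \<delta> *\<^sub>R (- p)"
      using xy(2) by (auto simp: algebra_simps)
    then show ?thesis
      using xy(1,3) mp unfolding extended_domain_def interaction_collar_def by blast
  qed
  then show ?thesis
    unfolding interaction_pairs_def by blast
qed

lemma scaled_membership:
  fixes P :: "'a::real_vector set"
  shows "\<delta> \<noteq> 0 \<Longrightarrow> w \<in> (*\<^sub>R) \<delta> ` P \<longleftrightarrow> w /\<^sub>R \<delta> \<in> P"
  by (force simp: image_iff)

lemma closed_relative_position:
  fixes S :: "'a::euclidean_space set"
  shows "closed S \<Longrightarrow> closed {(x, y). (y - x) /\<^sub>R \<delta> \<in> S}"
  using continuous_closed_vimage[of S "\<lambda>p. (snd p - fst p) /\<^sub>R \<delta>"]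
  by (auto simp: vimage_def case_prod_unfold intro!: continuous_intros)

lemma open_relative_position:
  fixes S :: "'a::euclidean_space set"
  shows "open S \<Longrightarrow> open {(x, y). (y - x) /\<^sub>R \<delta> \<in> S}"
  using continuous_open_vimage[of S "\<lambda>p. (snd p - fst p) /\<^sub>R \<delta>"]
  by (auto simp: vimage_def case_prod_unfold intro!: continuous_intros)

lemma zero_ext_fe_space_continuous:
  assumes "open \<Omega>" "v \<in> fe_space \<Omega> \<T>"
  shows "continuous_on UNIV (zero_ext \<Omega> v)"
proof -
  have "continuous_on (closure \<Omega> \<union> - \<Omega>) (\<lambda>x. if x \<in> \<Omega> then v x else 0)"
  proof (rule continuous_on_cases)
    show "\<forall>x. x \<in> closure \<Omega> \<and> x \<notin> \<Omega> \<or> x \<in> - \<Omega> \<and> x \<in> \<Omega> \<longrightarrow> v x = 0"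
      using assms by (auto simp: fe_space_def frontier_def interior_open)
  qed (use assms in \<open>auto simp: fe_space_def\<close>)
  moreover have "closure \<Omega> \<union> - \<Omega> = UNIV"
    using closure_subset by blast
  ultimately show ?thesis
    by (simp add: zero_ext_def[abs_def])
qed

lemma set_integrable_bounded_borel:
  fixes f :: "'b::euclidean_space \<Rightarrow> real"
  assumes "bounded S" "S \<in> sets borel" "continuous_on UNIV f"
  shows "set_integrable lebesgue S f"
proof -
  have "compact (closure S)"
    using assms(1) by (simp add: compact_closure)
  then have "set_integrable lborel (closure S) f"
    unfolding set_integrable_def
    by (intro borel_integrable_compact continuous_on_subset[OF assms(3)]) auto
  then have "set_integrable lborel S f"
    by (rule set_integrable_subset[OF _ _ closure_subset]) (simp add: assms(2))
  moreover have "(\<lambda>x. indicator S x *\<^sub>R f x) \<in> borel_measurable lborel"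
    using assms(2) borel_measurable_continuous_onI[OF assms(3)] by simp
  ultimately show ?thesis
    unfolding set_integrable_def by (simp add: integrable_completion)
qed

text \<open>Small relative positions \<open>(y - x) / \<delta>\<close> need only be tested on a dense set \<open>G\<close>: the kernel
  is bounded below in the interior of the cells, but not on their boundaries.\<close>

lemma eq_0_if_locally_constant_on_support:
  fixes w :: "'a::euclidean_space \<Rightarrow> real"
  assumes w: "continuous_on UNIV w" "\<And>x. x \<notin> \<Omega> \<Longrightarrow> w x = 0"
    and \<Omega>: "bounded \<Omega>" and r: "0 < r" "0 < \<delta>" and G: "ball 0 r \<subseteq> closure G"
    and const: "\<And>x z. x \<in> \<Omega> \<Longrightarrow> z \<in> G \<Longrightarrow> norm z < r \<Longrightarrow> w (x + \<delta> *\<^sub>R z) = w x"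
  shows "w x = 0"
proof -
  \<comment> \<open>For fixed \<open>x\<close> the set of good \<open>z\<close> is closed by
    continuity of \<open>w\<close>, so it contains the closure of the part of \<open>G\<close> in
    the ball.\<close>
  have near: "w (x + \<delta> *\<^sub>R z) = w x" if x: "x \<in> \<Omega>" and z: "norm z < r" for x z
  proof -
    have "ball 0 r \<inter> closure G \<subseteq> closure (ball 0 r \<inter> G)"
      by (rule open_Int_closure_subset) simp
    moreover have "z \<in> ball 0 r"
      using z by simp
    ultimately have "z \<in> closure (ball 0 r \<inter> G)"
      using G by blast
    moreover have "closed {z. w (x + \<delta> *\<^sub>R z) = w x}"
      by (intro closed_Collect_eq continuous_on_compose2[OF w(1)] continuous_intros) auto
    moreover have "ball 0 r \<inter> G \<subseteq> {z. w (x + \<delta> *\<^sub>R z) = w x}"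
      using const x by auto
    ultimately show ?thesis
      using closure_minimal by blast
  qed
  \<comment> \<open>If either point lies in \<open>\<Omega>\<close>, it serves as base point; if
    neither does, both values are 0. The radius is thus the same at every point of the space, and
    connectedness of the whole space can be used.\<close>
  have dist: "w y = w x" if "dist y x < \<delta> * r" for x y
  proof -
    have "norm ((y - x) /\<^sub>R \<delta>) < r" "norm ((x - y) /\<^sub>R \<delta>) < r"
      using that r(2) norm_minus_commute[of x y]
      by (simp_all add: dist_norm divide_inverse_commute[symmetric] pos_divide_less_eq mult.commute)
    then show ?thesis
      using near[of x "(y - x) /\<^sub>R \<delta>"] near[of y "(x - y) /\<^sub>R \<delta>"] w(2)[of x] w(2)[of y] r(2)
      by (cases "x \<in> \<Omega>"; cases "y \<in> \<Omega>") auto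
  qed
  have "w constant_on UNIV"
  proof (rule locally_constant_imp_constant[OF connected_UNIV])
    fix x
    show "\<exists>T. openin (top_of_set UNIV) T \<and> x \<in> T \<and> (\<forall>y\<in>T. w y = w x)"
    proof (intro exI conjI)
      show "\<forall>y\<in>ball x (\<delta> * r). w y = w x"
        using dist by (simp add: dist_commute)
    qed (use r in auto)
  qed
  moreover have "\<Omega> \<noteq> UNIV"
    using \<Omega> not_bounded_UNIV by auto
  then obtain b where "b \<notin> \<Omega>"
    by blast
  ultimately show ?thesis
    using w(2) by (metis UNIV_I constant_on_def)
qed

locale nonlocal_problem = symmetric_kernel_partition +
  fixes \<Omega> :: "'a set" and \<delta> :: real
  assumes domain: "lipschitz_polyhedral_domain \<Omega>" and \<delta>: "0 < \<delta>"
begin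

abbreviation "D \<equiv> extended_domain \<Omega> P \<delta>"
abbreviation "\<I> \<equiv> interaction_pairs \<Omega> P \<delta>"

lemma
  shows open_domain: "open \<Omega>" and bounded_domain: "bounded \<Omega>"
    and interior_closure_domain: "interior (closure \<Omega>) = \<Omega>"
  using domain interior_closure_lipschitz unfolding lipschitz_polyhedral_domain_def by auto

lemma zero_in_P: "0 \<in> P"
  using P(2) by auto

lemma closed_P: "closed P"
  using finite_cells Union_cells cell_compact compact_imp_closed by blast

lemma pairs_iff: "(x, y) \<in> \<I> \<longleftrightarrow> (x \<in> \<Omega> \<or> y \<in> \<Omega>) \<and> (y - x) /\<^sub>R \<delta> \<in> P"
  using \<delta> by (simp add: interaction_pairs_eq[OF zero_in_P P(1)] scaled_membership)

lemma pairs_extended_domain: "(x, y) \<in> \<I> \<Longrightarrow> x \<in> D \<and> y \<in> D"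
  by (auto simp: interaction_pairs_def)

lemma pairs_borel: "\<I> \<in> sets borel"
proof -
  have "\<I> = (\<Omega> \<times> UNIV \<union> UNIV \<times> \<Omega>) \<inter> {(x, y). (y - x) /\<^sub>R \<delta> \<in> P}"
    using pairs_iff by auto
  moreover have "open (\<Omega> \<times> (UNIV :: 'a set) \<union> (UNIV :: 'a set) \<times> \<Omega>)"
    using open_domain by (intro open_Un open_Times) auto
  ultimately show ?thesis
    using borel_closed[OF closed_relative_position[OF closed_P]] by (simp add: sets.Int)
qed

lemma bounded_pairs: "bounded \<I>"
proof -
  obtain M where M: "\<And>x. x \<in> \<Omega> \<Longrightarrow> norm x \<le> M"
    using bounded_domain by (auto simp: bounded_iff)
  have "\<I> \<subseteq> cball 0 (M + \<delta>) \<times> cball 0 (M + \<delta>)"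
  proof clarify
    fix x y assume xy: "(x, y) \<in> \<I>"
    then have "(y - x) /\<^sub>R \<delta> \<in> cball 0 1"
      using pairs_iff P(3) by blast
    then have "norm (y - x) / \<delta> \<le> 1"
      using \<delta> by (simp add: divide_inverse_commute)
    then have "norm (y - x) \<le> \<delta>"
      using \<delta> by (simp add: pos_divide_le_eq)
    moreover have "norm x \<le> M \<or> norm y \<le> M"
      using xy pairs_iff M by auto
    ultimately show "x \<in> cball 0 (M + \<delta>) \<and> y \<in> cball 0 (M + \<delta>)"
      using norm_triangle_ineq[of x "y - x"] norm_triangle_ineq[of y "x - y"] \<delta>
      by (auto simp: norm_minus_commute)
  qed
  then show ?thesis
    by (rule bounded_subset[rotated]) (intro bounded_Times bounded_cball)
qed

abbreviation form_density :: "('a \<Rightarrow> real) \<Rightarrow> ('a \<Rightarrow> real) \<Rightarrow> 'a \<times> 'a \<Rightarrow> real" where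
  "form_density u v \<equiv> \<lambda>p. case p of (x, y) \<Rightarrow> \<kappa> ((y - x) /\<^sub>R \<delta>) * (u y - u x) * (v y - v x)"

text \<open>The kernel is a finite combination of indicators of open cells, so the density splits
  into finitely many continuous functions on bounded Borel sets.\<close>

lemma form_density_integrable:
  assumes "continuous_on UNIV u" "continuous_on UNIV v"
  shows "set_integrable lebesgue \<I> (form_density u v)"
proof -
  define h where "h p = (u (snd p) - u (fst p)) * (v (snd p) - v (fst p))" for p
  define A where "A Z = \<I> \<inter> {(x, y). (y - x) /\<^sub>R \<delta> \<in> interior Z}" for Z
  have h: "continuous_on UNIV h"
    unfolding h_def by (intro continuous_intros continuous_on_compose2[OF assms(1)] continuous_on_compose2[OF assms(2)]) auto
  have "set_integrable lebesgue (A Z) h" for Z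
    unfolding A_def
    by (intro set_integrable_bounded_borel h sets.Int pairs_borel borel_open open_relative_position)
       (auto intro: bounded_subset[OF bounded_pairs])
  then have "integrable lebesgue (\<lambda>p. \<Sum>Z\<in>\<Z>. cell_average \<rho> Z * (indicator (A Z) p *\<^sub>R h p))"
    unfolding set_integrable_def by (intro Bochner_Integration.integrable_sum integrable_mult_right) auto
  moreover have "(\<Sum>Z\<in>\<Z>. cell_average \<rho> Z * (indicator (A Z) p *\<^sub>R h p)) = indicator \<I> p *\<^sub>R form_density u v p" for p
  proof -
    have "indicator \<I> p *\<^sub>R form_density u v p = \<kappa> ((snd p - fst p) /\<^sub>R \<delta>) * (indicator \<I> p * h p)"
      by (simp add: h_def case_prod_unfold)
    also have "\<dots> = (\<Sum>Z\<in>\<Z>. cell_average \<rho> Z * (indicator (A Z) p *\<^sub>R h p))"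
      unfolding averaged_kernel_def sum_distrib_right
      by (intro sum.cong refl) (auto simp: A_def indicator_def case_prod_unfold)
    finally show ?thesis by simp
  qed
  ultimately show ?thesis
    by (simp add: set_integrable_def)
qed

lemma nonlocal_form_commute: "nonlocal_form \<kappa> \<Omega> P \<delta> u v = nonlocal_form \<kappa> \<Omega> P \<delta> v u"
  unfolding nonlocal_form_def by (simp add: mult.assoc mult.commute mult.left_commute)

lemma nonlocal_form_double_sum:
  assumes "finite I" "\<And>i. i \<in> I \<Longrightarrow> continuous_on UNIV (f i)"
  shows "nonlocal_form \<kappa> \<Omega> P \<delta> (\<lambda>x. \<Sum>i\<in>I. c i * f i x) (\<lambda>x. \<Sum>i\<in>I. c i * f i x) =
    (\<Sum>i\<in>I. \<Sum>j\<in>I. c i * nonlocal_form \<kappa> \<Omega> P \<delta> (f j) (f i) * c j)"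
proof -
  have density: "form_density (\<lambda>x. \<Sum>i\<in>I. c i * f i x) (\<lambda>x. \<Sum>i\<in>I. c i * f i x) p =
      (\<Sum>i\<in>I. \<Sum>j\<in>I. c i * c j * form_density (f j) (f i) p)" for p
  proof (cases p)
    case (Pair x y)
    have "form_density (\<lambda>x. \<Sum>i\<in>I. c i * f i x) (\<lambda>x. \<Sum>i\<in>I. c i * f i x) p =
        \<kappa> ((y - x) /\<^sub>R \<delta>) * ((\<Sum>i\<in>I. c i * (f i y - f i x)) * (\<Sum>j\<in>I. c j * (f j y - f j x)))"
    proof -
      have "(\<Sum>i\<in>I. c i * f i y) - (\<Sum>i\<in>I. c i * f i x) = (\<Sum>i\<in>I. c i * (f i y - f i x))"
        by (simp add: sum_subtractf right_diff_distrib)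
      then show ?thesis
        by (simp add: Pair mult.assoc)
    qed
    then show ?thesis
      unfolding sum_product by (simp add: Pair sum_distrib_left mult_ac)
  qed
  have int: "integrable lebesgue (\<lambda>p. indicator \<I> p * form_density (f j) (f i) p)"
    if "i \<in> I" "j \<in> I" for i j
    using form_density_integrable[of "f j" "f i"] assms(2) that by (simp add: set_integrable_def)
  have "(LINT p:\<I>|lebesgue. form_density (\<lambda>x. \<Sum>i\<in>I. c i * f i x) (\<lambda>x. \<Sum>i\<in>I. c i * f i x) p) =
      (LINT p|lebesgue. (\<Sum>i\<in>I. \<Sum>j\<in>I. c i * c j * (indicator \<I> p * form_density (f j) (f i) p)))"
    unfolding set_lebesgue_integral_def density by (simp add: sum_distrib_left mult_ac)
  also have "\<dots> = (\<Sum>i\<in>I. \<Sum>j\<in>I. c i * c j * (LINT p:\<I>|lebesgue. form_density (f j) (f i) p))"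
    unfolding set_lebesgue_integral_def by (simp add: Bochner_Integration.integral_sum int)
  finally show ?thesis
    unfolding nonlocal_form_def by (simp add: sum_distrib_left mult_ac)
qed

section \<open>Positive definiteness of the form on finite element functions\<close>

lemma nonlocal_form_nonneg: "0 \<le> nonlocal_form \<kappa> \<Omega> P \<delta> w w"
  unfolding nonlocal_form_def set_lebesgue_integral_def using \<delta>
  by (intro mult_nonneg_nonneg integral_nonneg_AE AE_I2)
     (auto simp: indicator_def averaged_kernel_nonneg mult.assoc)

text \<open>Vanishing energy gives equality of \<open>w x\<close> and \<open>w y\<close> only for
  almost every interacting pair. The violating pairs with relative position in an open cell form an
  open set, and an open null set is empty, so equality holds for all such pairs.\<close>

lemma nonlocal_form_eq_0_imp:
  assumes w: "continuous_on UNIV w" "\<And>x. x \<notin> \<Omega> \<Longrightarrow> w x = 0"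
    and r: "0 < r" "r \<le> 1" "Max (diameter ` \<Z>) \<le> r / 2" and c: "0 < c"
    and low: "AE z in lebesgue. z \<in> ball 0 r \<longrightarrow> c \<le> \<rho> z"
    and zero: "nonlocal_form \<kappa> \<Omega> P \<delta> w w = 0"
  shows "w x = 0"
proof (rule eq_0_if_locally_constant_on_support[OF w bounded_domain, of "r / 2" \<delta>])
  define G where "G = (\<Union>Z\<in>\<Z>. interior Z)"
  have "open G"
    by (auto simp: G_def)
  have PG: "P \<subseteq> closure (G)"
  proof
    fix x assume "x \<in> P"
    then obtain Z where Z: "Z \<in> \<Z>" "x \<in> Z"
      using Union_cells by blast
    \<comment> \<open>A convex set without interior is null, which positive cell measure forbids;
      with nonempty interior, a convex cell lies in the closure of that interior.\<close>
    have "interior Z \<noteq> {}"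
      using cell_pos[OF Z(1)] negligible_convex_interior[OF cell_convex[OF Z(1)]]
        negligible_imp_measure0[of Z] by auto
    then have "x \<in> closure (interior Z)"
      using convex_closure_interior[OF cell_convex[OF Z(1)]] Z(2) closure_subset by blast
    then show "x \<in> closure G"
      using closure_mono[of "interior Z" G] Z(1) by (auto simp: G_def)
  qed
  moreover have rP: "ball 0 (r / 2) \<subseteq> P"
    using P(2) r(2) subset_ball[of "r / 2" "1 / 2" "0 :: 'a"] by auto
  ultimately show "ball 0 (r / 2) \<subseteq> closure G"
    by blast
  \<comment> \<open>Restricting to the open set \<open>G\<close> keeps \<open>B\<close> open and
    also keeps the kernel above \<open>c\<close>, so the density is nonzero on all of
    \<open>B\<close>.\<close>
  define B where "B = {p. w (fst p) \<noteq> w (snd p)} \<inter> (\<Omega> \<times> UNIV \<inter> {(x, y). (y - x) /\<^sub>R \<delta> \<in> G \<inter> ball 0 (r / 2)})"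
  have "open B"
    unfolding B_def
    by (intro open_Int open_Times open_domain open_relative_position \<open>open G\<close> open_Collect_neq
      continuous_on_compose2[OF w(1)] continuous_intros) auto
  have "(LINT p|lebesgue. indicator \<I> p *\<^sub>R form_density w w p) = 0"
    using zero \<delta> by (simp add: nonlocal_form_def set_lebesgue_integral_def)
  moreover have nn: "AE p in lebesgue. 0 \<le> indicator \<I> p *\<^sub>R form_density w w p"
    by (intro AE_I2) (auto simp: indicator_def averaged_kernel_nonneg mult.assoc)
  ultimately have "AE p in lebesgue. indicator \<I> p *\<^sub>R form_density w w p = 0"
    using form_density_integrable[OF w(1) w(1)] integral_nonneg_eq_0_iff_AE[OF _ nn]
    by (simp add: set_integrable_def)
  then obtain N where N: "negligible N" "\<And>p. p \<notin> N \<Longrightarrow> indicator \<I> p *\<^sub>R form_density w w p = 0"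
    by (rule AE_lebesgue_negligible) blast
  have "B \<subseteq> N"
  proof
    fix p assume "p \<in> B"
    then obtain x y where p: "p = (x, y)" "w x \<noteq> w y" "x \<in> \<Omega>" "(y - x) /\<^sub>R \<delta> \<in> G" "(y - x) /\<^sub>R \<delta> \<in> ball 0 (r / 2)"
      by (auto simp: B_def)
    have "c \<le> \<kappa> ((y - x) /\<^sub>R \<delta>)"
      using p(4,5) averaged_kernel_lower_bound_interior[OF _ _ p(5) r low] by (auto simp: G_def)
    then have "\<kappa> ((y - x) /\<^sub>R \<delta>) * (w y - w x) * (w y - w x) \<noteq> 0"
      using c p(2) by auto
    moreover have "(x, y) \<in> \<I>"
      using p(3,5) rP pairs_iff by blast
    ultimately show "p \<in> N"
      using N(2)[of p] p(1) by auto
  qed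
  then have "B = {}"
    using \<open>open B\<close> N(1) negligible_subset open_not_negligible by blast
  show "w (x + \<delta> *\<^sub>R z) = w x" if "x \<in> \<Omega>" "z \<in> G" "norm z < r / 2" for x z
  proof (rule ccontr)
    assume neq: "w (x + \<delta> *\<^sub>R z) \<noteq> w x"
    define y where "y = x + \<delta> *\<^sub>R z"
    have "(y - x) /\<^sub>R \<delta> = z"
      using \<delta> by (simp add: y_def)
    then have "(x, y) \<in> B"
      using that neq by (simp add: B_def y_def[symmetric] del: norm_scaleR)
    then show False
      using \<open>B = {}\<close> by blast
  qed
qed (use r \<delta> in auto)

lemma stiffness_matrix_spd:
  assumes basis: "nodal_basis \<Omega> \<T> N \<phi>"
    and r: "0 < r" "r \<le> 1" "Max (diameter ` \<Z>) \<le> r / 2" and c: "0 < c"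
    and low: "AE z in lebesgue. z \<in> ball 0 r \<longrightarrow> c \<le> \<rho> z"
  shows "sym_positive_definite N (stiffness_matrix \<kappa> \<Omega> P \<delta> \<phi>)"
  unfolding sym_positive_definite_def
proof (intro conjI ballI allI impI)
  show "stiffness_matrix \<kappa> \<Omega> P \<delta> \<phi> i j = stiffness_matrix \<kappa> \<Omega> P \<delta> \<phi> j i" for i j
    unfolding stiffness_matrix_def by (rule nonlocal_form_commute)
next
  fix b :: "nat \<Rightarrow> real" assume "\<exists>i\<in>{1..N}. b i \<noteq> 0"
  then obtain k where k: "k \<in> {1..N}" "b k \<noteq> 0"
    by blast
  obtain z where z: "bij_betw z {1..N} (interior_nodes \<Omega> \<T>)"
    and \<phi>: "\<And>i. i \<in> {1..N} \<Longrightarrow> \<phi> i \<in> fe_space \<Omega> \<T>"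
    and nodal: "\<And>i j. i \<in> {1..N} \<Longrightarrow> j \<in> {1..N} \<Longrightarrow> \<phi> i (z j) = (if i = j then 1 else 0)"
    using basis unfolding nodal_basis_def by blast
  define w where "w x = (\<Sum>i\<in>{1..N}. b i * zero_ext \<Omega> (\<phi> i) x)" for x
  have cont: "continuous_on UNIV (zero_ext \<Omega> (\<phi> i))" if "i \<in> {1..N}" for i
    using zero_ext_fe_space_continuous[OF open_domain \<phi>[OF that]] .
  then have w: "continuous_on UNIV w"
    unfolding w_def by (intro continuous_intros) auto
  have w0: "w x = 0" if "x \<notin> \<Omega>" for x
    using that by (simp add: w_def zero_ext_def)
  have form: "(\<Sum>i=1..N. \<Sum>j=1..N. b i * stiffness_matrix \<kappa> \<Omega> P \<delta> \<phi> i j * b j) = nonlocal_form \<kappa> \<Omega> P \<delta> w w"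
    unfolding stiffness_matrix_def w_def[abs_def]
    by (rule nonlocal_form_double_sum[symmetric]) (auto simp: cont)
  \<comment> \<open>Interior nodes lie in \<open>\<Omega>\<close>, where zero extension changes
    nothing, so \<open>w\<close> takes the value \<open>b k\<close> at this node and is not
    identically zero.\<close>
  have "z k \<in> \<Omega>"
    using bij_betwE[OF z] k(1) by (auto simp: interior_nodes_def)
  then have "w (z k) = (\<Sum>i\<in>{1..N}. if i = k then b k else 0)"
    unfolding w_def using k(1) nodal by (intro sum.cong) (auto simp: zero_ext_def)
  then have "w (z k) \<noteq> 0"
    using k by simp
  then have "nonlocal_form \<kappa> \<Omega> P \<delta> w w \<noteq> 0"
    using nonlocal_form_eq_0_imp[OF w w0 r c low] by blast
  then show "0 < (\<Sum>i=1..N. \<Sum>j=1..N. b i * stiffness_matrix \<kappa> \<Omega> P \<delta> \<phi> i j * b j)"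
    unfolding form using nonlocal_form_nonneg[of w] by linarith
qed

end

section \<open>Pair-cell assembly\<close>

text \<open>Integrability is transported from the smaller set to the larger one. This direction lets
  a discontinuous integrand be handled first on open simplices and only then on all interaction
  pairs.\<close>

lemma set_lebesgue_integral_spike_set:
  fixes f :: "'b::euclidean_space \<Rightarrow> real"
  assumes f: "set_integrable lebesgue S f" and ST: "S \<subseteq> T" "negligible (T - S)"
  shows "set_integrable lebesgue T f" "(LINT x:T|lebesgue. f x) = (LINT x:S|lebesgue. f x)"
proof -
  have neg: "negligible {x \<in> S - T. f x \<noteq> 0}" "negligible {x \<in> T - S. f x \<noteq> 0}"
    using ST by (auto intro: negligible_subset)
  show T: "set_integrable lebesgue T f"
    using absolutely_integrable_spike_set_eq[OF neg] f by simp
  show "(LINT x:T|lebesgue. f x) = (LINT x:S|lebesgue. f x)"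
    using integral_spike_set[OF neg] set_lebesgue_integral_eq_integral(2)[OF T]
      set_lebesgue_integral_eq_integral(2)[OF f] by simp
qed

lemma full_simplex_facts:
  fixes T :: "'b::euclidean_space set"
  assumes "int DIM('b) simplex T"
  shows "compact T" "convex T" "aff_dim T = int DIM('b)" "interior T \<noteq> {}" "closure (interior T) = T"
    and "bounded (interior T)"
proof -
  show c: "compact T" "convex T" "aff_dim T = int DIM('b)"
    using assms compact_simplex convex_simplex aff_dim_simplex by blast+
  have "affine hull T = UNIV" "T \<noteq> {}"
    using c(3) aff_dim_eq_full[of T] by auto
  then show i: "interior T \<noteq> {}"
    using rel_interior_interior rel_interior_eq_empty[OF c(2)] by metis
  show "closure (interior T) = T"
    using convex_closure_interior[OF c(2) i] c(1) by (simp add: compact_imp_closed)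
  show "bounded (interior T)"
    using compact_imp_bounded[OF c(1)] interior_subset by (rule bounded_subset)
qed

lemma real_DIM_pair: "real DIM('a \<times> 'a) = 2 * real DIM('a::euclidean_space)"
  by simp

text \<open>The rule for general \<open>n\<close>-simplices is specialized to the product space,
  where \<open>n = 2 d\<close>.\<close>

lemma quad_constants:
  "(1 + real DIM('a \<times> 'a) / sqrt (real DIM('a \<times> 'a) + 2)) / (real DIM('a \<times> 'a) + 1) = quad_theta DIM('a::euclidean_space)"
  "(1 - 1 / sqrt (real DIM('a \<times> 'a) + 2)) / (real DIM('a \<times> 'a) + 1) = quad_vartheta DIM('a)"
  unfolding real_DIM_pair quad_theta_def quad_vartheta_def by (rule refl)+

lemma quad_node_interior:
  fixes R :: "('a::euclidean_space \<times> 'a) set"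
  assumes "int DIM('a \<times> 'a) simplex R" "v extreme_point_of R"
  shows "quad_node (T, S, Z, R, v) \<in> interior R"
  using simplex_quadrature_exact(2)[OF assms] by (simp only: quad_constants quad_node.simps)

text \<open>The integral is over the open simplex because only there is the form integrand known to
  be a cell average times affine factors; the frontier of a convex set is null.\<close>

lemma pair_quadrature_exact:
  fixes R :: "('a::euclidean_space \<times> 'a) set"
  assumes R: "int DIM('a \<times> 'a) simplex R"
  shows "(LINT p:interior R|lebesgue. (a \<bullet> p + \<alpha>) * (b \<bullet> p + \<beta>)) =
    (\<Sum>v | v extreme_point_of R. quad_weight (T, S, Z, R, v) *
      ((a \<bullet> quad_node (T, S, Z, R, v) + \<alpha>) * (b \<bullet> quad_node (T, S, Z, R, v) + \<beta>)))"
proof -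
  let ?f = "\<lambda>p. (a \<bullet> p + \<alpha>) * (b \<bullet> p + \<beta>)"
  note R_facts = full_simplex_facts[OF R]
  have [measurable]: "R \<in> sets borel"
    using R_facts(1) by (simp add: borel_compact)
  have int: "set_integrable lebesgue (interior R) ?f"
    by (intro set_integrable_bounded_borel continuous_intros R_facts(6)) auto
  have "R - interior R = frontier R"
    using R_facts(1) by (simp add: frontier_def compact_imp_closed)
  then have "(LINT p:interior R|lebesgue. ?f p) = (LINT p:R|lebesgue. ?f p)"
    using set_lebesgue_integral_spike_set(2)[OF int interior_subset]
      negligible_convex_frontier[OF R_facts(2)] by simp
  also have "\<dots> = (LINT p:R|lborel. ?f p)"
  proof -
    have "?f \<in> borel_measurable borel"
      by (intro borel_measurable_continuous_onI continuous_intros)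
    then show ?thesis
      unfolding set_lebesgue_integral_def by (intro integral_completion) simp
  qed
  also have "\<dots> = (\<Sum>v | v extreme_point_of R. quad_weight (T, S, Z, R, v) *
      ((a \<bullet> quad_node (T, S, Z, R, v) + \<alpha>) * (b \<bullet> quad_node (T, S, Z, R, v) + \<beta>)))"
  proof -
    have weight: "quad_weight (T, S, Z, R, v) = measure lborel R / (real DIM('a \<times> 'a) + 1)" for v
      unfolding real_DIM_pair by simp
    show ?thesis
      unfolding weight quad_node.simps
      using simplex_quadrature_exact(1)[OF R, of a \<alpha> b \<beta>] by (simp only: quad_constants)
  qed
  finally show ?thesis .
qed

locale pair_cell_assembly = nonlocal_problem +
  fixes \<T> \<T>' :: "'a set set" and \<R> :: "'a set \<Rightarrow> 'a set \<Rightarrow> 'a set \<Rightarrow> ('a \<times> 'a) set set"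
  assumes mesh: "conforming_mesh \<Omega> \<T>"
    and extension: "extension_mesh \<Omega> P \<delta> \<T> \<T>'"
    and subdivision: "pair_cell_subdivision \<Omega> P \<delta> \<T>' \<Z> \<R>"
begin

section \<open>Geometry of the extended mesh and of the pair cells\<close>

lemma
  shows finite_mesh: "finite \<T>'"
    and mesh_subset: "\<T> \<subseteq> \<T>'"
    and element_simplex: "T \<in> \<T>' \<Longrightarrow> int DIM('a) simplex T"
    and element_Int_face: "T \<in> \<T>' \<Longrightarrow> S \<in> \<T>' \<Longrightarrow> (T \<inter> S) face_of T"
    and Union_mesh: "\<Union>\<T> = closure \<Omega>"
    and Union_extension: "\<Union>\<T>' = closure D"
  using mesh extension unfolding conforming_mesh_def extension_mesh_def triangulation_def by blast+

lemmas element_facts = full_simplex_facts[OF element_simplex]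

text \<open>Were \<open>T\<close> contained in \<open>S\<close>, it would be a proper face of
  \<open>S\<close>, hence of smaller dimension, although both are full simplices. So the common face
  is proper in \<open>T\<close> and avoids its interior. Disjointness from the closed
  \<open>S\<close> is what later separates collar elements from the closure of
  \<open>\<Omega>\<close>.\<close>

lemma interior_element_disjoint:
  assumes "T \<in> \<T>'" "S \<in> \<T>'" "T \<noteq> S"
  shows "interior T \<inter> S = {}"
proof -
  have "T \<inter> S \<noteq> T"
  proof
    assume TS: "T \<inter> S = T"
    then have "T face_of S"
      using element_Int_face[OF assms(2,1)] by (simp add: Int_commute)
    then have "aff_dim T < aff_dim S"
      using face_of_aff_dim_lt element_facts(2)[OF assms(2)] assms(3) by blast
    then show False
      using element_facts(3) assms by simp
  qed
  then have "(T \<inter> S) \<inter> interior T = {}"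
    using face_of_disjoint_interior element_Int_face assms by blast
  then show ?thesis
    using interior_subset by blast
qed

lemma interior_domain_element: "T \<in> \<T> \<Longrightarrow> interior T \<subseteq> \<Omega>"
  using Union_mesh interior_mono[of T "closure \<Omega>"] interior_closure_domain by blast

text \<open>The closure of \<open>\<Omega>\<close> is a union of elements of \<open>\<T>\<close>,
  each missing the interior of \<open>T\<close>. As \<open>\<Omega>\<close> is open and
  \<open>T\<close> is the closure of its interior, even the closed element avoids
  \<open>\<Omega>\<close>.\<close>

lemma collar_element:
  assumes "T \<in> \<T>'" "T \<notin> \<T>"
  shows "interior T \<inter> closure \<Omega> = {}" "T \<inter> \<Omega> = {}"
proof -
  show i: "interior T \<inter> closure \<Omega> = {}"
    unfolding Union_mesh[symmetric] using interior_element_disjoint assms mesh_subset by blast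
  have "closure (interior T) \<inter> \<Omega> = {}"
    using i closure_subset[of \<Omega>] open_Int_closure_eq_empty[OF open_domain, of "interior T"] by blast
  then show "T \<inter> \<Omega> = {}"
    using element_facts(5)[OF assms(1)] by simp
qed

text \<open>This is the hypothesis under which \<open>collar_data\<close> prescribes an affine
  function. It is proved for the interior, which avoids the closure of \<open>\<Omega>\<close>, and
  then passed to the closure.\<close>

lemma collar_element_subset:
  assumes "T \<in> \<T>'" "T \<notin> \<T>"
  shows "T \<subseteq> closure (interaction_collar \<Omega> P \<delta>)"
proof -
  have "T \<subseteq> closure \<Omega> \<union> closure (interaction_collar \<Omega> P \<delta>)"
    using Union_extension assms(1) by (auto simp: extended_domain_def)
  then have "interior T \<subseteq> closure (interaction_collar \<Omega> P \<delta>)"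
    using collar_element(1)[OF assms] interior_subset by blast
  then have "closure (interior T) \<subseteq> closure (interaction_collar \<Omega> P \<delta>)"
    by (simp add: closure_minimal)
  then show ?thesis
    using element_facts(5)[OF assms(1)] by simp
qed

abbreviation "cell T S Z \<equiv> pair_cell \<Omega> P \<delta> T S Z"

lemma cell_lmeasurable:
  assumes "T \<in> \<T>'" "S \<in> \<T>'" "Z \<in> \<Z>"
  shows "cell T S Z \<in> lmeasurable"
proof -
  have eq: "cell T S Z = (T \<times> S) \<inter> \<I> \<inter> {(x, y). (y - x) /\<^sub>R \<delta> \<in> Z}"
    by (auto simp: pair_cell_def)
  have "closed Z"
    using cell_compact[OF assms(3)] compact_imp_closed by blast
  moreover have "closed (T \<times> S)"
    using element_facts(1) assms compact_imp_closed by (intro closed_Times) auto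
  ultimately have "cell T S Z \<in> sets borel"
    unfolding eq by (intro sets.Int[OF sets.Int[OF borel_closed pairs_borel] borel_closed] closed_relative_position)
  moreover have "bounded (cell T S Z)"
    using bounded_pairs by (rule bounded_subset) (auto simp: eq)
  ultimately show ?thesis
    by (intro bounded_set_imp_lmeasurable) auto
qed

text \<open>The closure of a pair cell may contain pairs with both points outside the open set
  \<open>\<Omega>\<close>. Taking the interior of the closure discards them, so everything inside an
  open quadrature simplex is again a genuine interaction pair.\<close>

lemma interior_closure_cell:
  assumes TSZ: "T \<in> \<T>'" "S \<in> \<T>'" "Z \<in> \<Z>" and pos: "0 < measure lebesgue (cell T S Z)"
    and p: "(x, y) \<in> interior (closure (cell T S Z))"
  shows "x \<in> interior T" "y \<in> interior S" "(y - x) /\<^sub>R \<delta> \<in> interior Z" "(x, y) \<in> \<I>"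
proof -
  have "closure (cell T S Z) \<subseteq> (T \<times> S) \<inter> {(x, y). (y - x) /\<^sub>R \<delta> \<in> Z}"
    using element_facts(1) TSZ cell_compact compact_imp_closed
    by (intro closure_minimal closed_Int closed_Times closed_relative_position)
       (auto simp: pair_cell_def)
  from interior_mono[OF this] have sub: "(x, y) \<in> interior T \<times> interior S"
    and rel: "(x, y) \<in> interior {(x, y). (y - x) /\<^sub>R \<delta> \<in> Z}"
    using p by (auto simp: interior_Times)
  show xT: "x \<in> interior T" and yS: "y \<in> interior S"
    using sub by auto
  \<comment> \<open>The slice of this open set at fixed \<open>x\<close>, parametrized by the
    relative position \<open>z\<close>, is an open subset of \<open>Z\<close> and therefore lies in
    its interior.\<close>
  define O' where "O' = interior {(x, y). (y - x) /\<^sub>R \<delta> \<in> Z}"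
  have "open {z. (x, x + \<delta> *\<^sub>R z) \<in> O'}"
    using continuous_open_vimage[of O' "\<lambda>z. (x, x + \<delta> *\<^sub>R z)"]
    by (auto simp: vimage_def O'_def intro!: continuous_intros)
  moreover have "{z. (x, x + \<delta> *\<^sub>R z) \<in> O'} \<subseteq> Z"
  proof
    fix z assume "z \<in> {z. (x, x + \<delta> *\<^sub>R z) \<in> O'}"
    then have "(x, x + \<delta> *\<^sub>R z) \<in> {(x, y). (y - x) /\<^sub>R \<delta> \<in> Z}"
      using interior_subset unfolding O'_def by blast
    then show "z \<in> Z"
      using \<delta> by simp
  qed
  ultimately have "{z. (x, x + \<delta> *\<^sub>R z) \<in> O'} \<subseteq> interior Z"
    by (rule interior_maximal[rotated])
  moreover have "(y - x) /\<^sub>R \<delta> \<in> {z. (x, x + \<delta> *\<^sub>R z) \<in> O'}"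
    using rel \<delta> by (simp add: O'_def)
  ultimately show yxZ: "(y - x) /\<^sub>R \<delta> \<in> interior Z"
    by blast
  \<comment> \<open>Two collar elements both miss \<open>\<Omega>\<close> and would give an empty
    pair cell, contradicting its positive measure.\<close>
  have "T \<in> \<T> \<or> S \<in> \<T>"
  proof (rule ccontr)
    assume "\<not> (T \<in> \<T> \<or> S \<in> \<T>)"
    then have "cell T S Z = {}"
      using collar_element(2)[of T] collar_element(2)[of S] TSZ pairs_iff
      unfolding pair_cell_def by blast
    then show False
      using pos by simp
  qed
  then have "x \<in> \<Omega> \<or> y \<in> \<Omega>"
    using interior_domain_element xT yS by blast
  moreover have "(y - x) /\<^sub>R \<delta> \<in> P"
    using yxZ interior_subset Union_cells TSZ(3) by blast
  ultimately show "(x, y) \<in> \<I>"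
    by (simp add: pairs_iff)
qed

section \<open>Basis functions and lifting as piecewise affine functions\<close>

lemma zero_ext_affine:
  assumes "v \<in> fe_space \<Omega> \<T>" "T \<in> \<T>'"
  shows "affine_fun_on (interior T \<inter> D) (zero_ext \<Omega> v)"
proof (cases "T \<in> \<T>")
  case True
  then obtain a b where ab: "\<And>x. x \<in> T \<Longrightarrow> v x = a \<bullet> x + b"
    using assms(1) unfolding fe_space_def affine_fun_on_def by blast
  show ?thesis
    unfolding affine_fun_on_def
    using ab interior_domain_element[OF True] interior_subset[of T]
    by (intro exI[of _ a] exI[of _ b]) (auto simp: zero_ext_def)
next
  case False
  have "zero_ext \<Omega> v x = 0 \<bullet> x + 0" if "x \<in> interior T" for x
    using collar_element(2)[OF assms(2) False] interior_subset that by (auto simp: zero_ext_def)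
  then show ?thesis
    unfolding affine_fun_on_def by blast
qed

lemma lifting_affine:
  assumes g: "collar_data \<Omega> P \<delta> \<T>' g" and "T \<in> \<T>'"
  shows "affine_fun_on (interior T \<inter> D) (lifting \<Omega> P \<delta> g)"
proof (cases "T \<in> \<T>")
  case True
  have "lifting \<Omega> P \<delta> g x = 0 \<bullet> x + 0" if "x \<in> interior T" for x
    using interior_domain_element[OF True] that
    by (auto simp: lifting_def zero_ext_def interaction_collar_def)
  then show ?thesis
    unfolding affine_fun_on_def by blast
next
  case False
  have "affine_fun_on (interior T \<inter> interaction_collar \<Omega> P \<delta>) g"
    using g assms(2) collar_element_subset[OF assms(2) False] by (simp add: collar_data_def)
  then obtain a b where "\<And>x. x \<in> interior T \<inter> interaction_collar \<Omega> P \<delta> \<Longrightarrow> g x = a \<bullet> x + b"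
    unfolding affine_fun_on_def by blast
  moreover have "interior T \<inter> D \<subseteq> interaction_collar \<Omega> P \<delta>"
    using collar_element(2)[OF assms(2) False] interior_subset[of T] by (auto simp: extended_domain_def)
  ultimately show ?thesis
    unfolding affine_fun_on_def
    by (intro exI[of _ a] exI[of _ b]) (auto simp: lifting_def zero_ext_def)
qed

text \<open>Interiors are used since the lifting may jump across element boundaries. The cut with
  \<open>D\<close> is needed because elements fill the closure of \<open>D\<close>, and off
  \<open>D\<close> the lifting is 0 instead of following its affine formula.\<close>

abbreviation piecewise_affine :: "('a \<Rightarrow> real) \<Rightarrow> bool" where
  "piecewise_affine u \<equiv> \<forall>T\<in>\<T>'. affine_fun_on (interior T \<inter> D) u"

section \<open>Exhaustion of the interaction pairs by open simplices\<close>

definition simplex_indices :: "('a set \<times> 'a set \<times> 'a set \<times> ('a \<times> 'a) set) set" where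
  "simplex_indices = {(T, S, Z, R). T \<in> \<T>' \<and> S \<in> \<T>' \<and> Z \<in> \<Z> \<and>
     0 < measure lebesgue (cell T S Z) \<and> R \<in> \<R> T S Z}"

lemma simplex_index:
  assumes "(T, S, Z, R) \<in> simplex_indices"
  shows "T \<in> \<T>'" "S \<in> \<T>'" "Z \<in> \<Z>" "0 < measure lebesgue (cell T S Z)"
    and "simplicial_partition (cell T S Z) (\<R> T S Z)" "R \<in> \<R> T S Z"
    and "int DIM('a \<times> 'a) simplex R"
    and "interior R \<subseteq> interior (closure (cell T S Z))"
proof -
  show k: "T \<in> \<T>'" "S \<in> \<T>'" "Z \<in> \<Z>" "0 < measure lebesgue (cell T S Z)" "R \<in> \<R> T S Z"
    using assms by (auto simp: simplex_indices_def)
  show part: "simplicial_partition (cell T S Z) (\<R> T S Z)"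
    using subdivision k by (simp add: pair_cell_subdivision_def)
  show "int DIM('a \<times> 'a) simplex R" "interior R \<subseteq> interior (closure (cell T S Z))"
    using part k(5) interior_mono[of R "closure (cell T S Z)"]
    unfolding simplicial_partition_def by blast+
qed

lemma interior_simplex:
  assumes "(T, S, Z, R) \<in> simplex_indices" "(x, y) \<in> interior R"
  shows "x \<in> interior T" "y \<in> interior S" "(y - x) /\<^sub>R \<delta> \<in> interior Z" "(x, y) \<in> \<I>" "x \<in> D" "y \<in> D"
proof -
  have "(x, y) \<in> interior (closure (cell T S Z))"
    using simplex_index(8)[OF assms(1)] assms(2) by blast
  note * = interior_closure_cell[OF simplex_index(1-4)[OF assms(1)] this]
  show "x \<in> interior T" "y \<in> interior S" "(y - x) /\<^sub>R \<delta> \<in> interior Z" "(x, y) \<in> \<I>"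
    by (fact *)+
  show "x \<in> D" "y \<in> D"
    using pairs_extended_domain[OF *(4)] by auto
qed

lemma finite_simplex_indices: "finite simplex_indices"
proof -
  have "simplex_indices \<subseteq> (\<Union>T\<in>\<T>'. \<Union>S\<in>\<T>'. \<Union>Z\<in>\<Z>.
      if 0 < measure lebesgue (cell T S Z) then (\<lambda>R. (T, S, Z, R)) ` \<R> T S Z else {})"
    by (auto simp: simplex_indices_def)
  moreover have "finite (\<R> T S Z)"
    if "T \<in> \<T>'" "S \<in> \<T>'" "Z \<in> \<Z>" "0 < measure lebesgue (cell T S Z)" for T S Z
    using that subdivision by (simp add: pair_cell_subdivision_def simplicial_partition_def)
  ultimately show ?thesis
    using finite_mesh finite_cells by (elim finite_subset) auto
qed

definition simplex_interior :: "'a set \<times> 'a set \<times> 'a set \<times> ('a \<times> 'a) set \<Rightarrow> ('a \<times> 'a) set" where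
  "simplex_interior = (\<lambda>(T, S, Z, R). interior R)"

text \<open>A common point \<open>(x, y)\<close> determines \<open>T\<close> from \<open>x\<close>,
  \<open>S\<close> from \<open>y\<close> and \<open>Z\<close> from the relative position, so the two
  simplices belong to the same subdivision, where overlaps are null.\<close>

lemma disjoint_simplex_interiors: "disjoint_family_on simplex_interior simplex_indices"
  unfolding disjoint_family_on_def
proof (intro ballI impI)
  fix k k' assume k: "k \<in> simplex_indices" "k' \<in> simplex_indices" "k \<noteq> k'"
  obtain T S Z R T' S' Z' R' where kk: "k = (T, S, Z, R)" "k' = (T', S', Z', R')"
    by (cases k, cases k') auto
  note k1 = k(1)[unfolded kk] and k2 = k(2)[unfolded kk]
  show "simplex_interior k \<inter> simplex_interior k' = {}"
  proof (rule ccontr)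
    assume "simplex_interior k \<inter> simplex_interior k' \<noteq> {}"
    then obtain x y where xy: "(x, y) \<in> interior R" "(x, y) \<in> interior R'"
      by (auto simp: simplex_interior_def kk)
    note i1 = interior_simplex[OF k1 xy(1)] and i2 = interior_simplex[OF k2 xy(2)]
    have "T = T'" "S = S'"
      using interior_element_disjoint[of T T'] interior_element_disjoint[of S S'] i1 i2
        simplex_index[OF k1] simplex_index[OF k2] interior_subset by blast+
    moreover have "Z = Z'"
      using interior_cells_disjoint[of Z Z'] i1 i2 simplex_index[OF k1] simplex_index[OF k2] by blast
    ultimately have "R \<noteq> R'" "R \<in> \<R> T S Z" "R' \<in> \<R> T S Z"
      using k(3) kk simplex_index[OF k1] simplex_index[OF k2] by auto
    then have "negligible (R \<inter> R')"
      using simplex_index(5)[OF k1] unfolding simplicial_partition_def pairwise_def by blast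
    then show False
      using interior_Int_interior_empty xy by blast
  qed
qed

lemma Union_simplex_interiors:
  shows "(\<Union>k\<in>simplex_indices. simplex_interior k) \<subseteq> \<I>"
    and "negligible (\<I> - (\<Union>k\<in>simplex_indices. simplex_interior k))"
proof -
  let ?E = "\<Union>k\<in>simplex_indices. simplex_interior k"
  show "?E \<subseteq> \<I>"
    using interior_simplex(4) by (auto simp: simplex_interior_def)
  have cell: "negligible (cell T S Z - ?E)" if TSZ: "T \<in> \<T>'" "S \<in> \<T>'" "Z \<in> \<Z>" for T S Z
  proof (cases "0 < measure lebesgue (cell T S Z)")
    case True
    then have part: "simplicial_partition (cell T S Z) (\<R> T S Z)"
      using subdivision TSZ by (simp add: pair_cell_subdivision_def)
    show ?thesis
    proof (rule negligible_subset)
      show "negligible (\<Union>R\<in>\<R> T S Z. frontier R)"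
        using part full_simplex_facts(2) negligible_convex_frontier
        unfolding simplicial_partition_def by (intro negligible_Union) blast+
      show "cell T S Z - ?E \<subseteq> (\<Union>R\<in>\<R> T S Z. frontier R)"
      proof
        fix p assume p: "p \<in> cell T S Z - ?E"
        then have "p \<in> \<Union>(\<R> T S Z)"
          using part closure_subset unfolding simplicial_partition_def by blast
        then obtain R where R: "R \<in> \<R> T S Z" "p \<in> R"
          by blast
        then have "(T, S, Z, R) \<in> simplex_indices"
          using TSZ True by (simp add: simplex_indices_def)
        then have "p \<notin> interior R"
          using p by (force simp: simplex_interior_def)
        then show "p \<in> (\<Union>R\<in>\<R> T S Z. frontier R)"
          using R closure_subset[of R] by (auto simp: frontier_def)
      qed
    qed
  next
    \<comment> \<open>A null pair cell has no quadrature nodes; discarding it loses only a null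
      set.\<close>
    case False
    then have "measure lebesgue (cell T S Z) = 0"
      using measure_nonneg[of lebesgue "cell T S Z"] by linarith
    then have "negligible (cell T S Z)"
      using cell_lmeasurable[OF TSZ] negligible_iff_measure by blast
    then show ?thesis
      by (rule negligible_subset) blast
  qed
  have "negligible (\<Union>(T, S, Z)\<in>\<T>' \<times> \<T>' \<times> \<Z>. cell T S Z - ?E)"
    using finite_mesh finite_cells cell by (intro negligible_Union) auto
  moreover have "\<I> - ?E \<subseteq> (\<Union>(T, S, Z)\<in>\<T>' \<times> \<T>' \<times> \<Z>. cell T S Z - ?E)"
  proof clarify
    fix x y assume xy: "(x, y) \<in> \<I>" "(x, y) \<notin> ?E"
    have "x \<in> \<Union>\<T>'" "y \<in> \<Union>\<T>'"
      unfolding Union_extension using pairs_extended_domain[OF xy(1)] closure_subset[of D] by auto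
    moreover have "(y - x) /\<^sub>R \<delta> \<in> \<Union>\<Z>"
      unfolding Union_cells using xy(1) pairs_iff by simp
    ultimately obtain T S Z where "T \<in> \<T>'" "S \<in> \<T>'" "Z \<in> \<Z>" "(x, y) \<in> cell T S Z"
      using xy(1) unfolding pair_cell_def by blast
    then show "(x, y) \<in> (\<Union>(T, S, Z)\<in>\<T>' \<times> \<T>' \<times> \<Z>. cell T S Z - ?E)"
      using xy(2) by (intro UN_I[of "(T, S, Z)"]) auto
  qed
  ultimately show "negligible (\<I> - ?E)"
    by (rule negligible_subset)
qed

lemma difference_affine:
  assumes k: "(T, S, Z, R) \<in> simplex_indices" and u: "piecewise_affine u"
  obtains a \<alpha> where "\<And>x y. (x, y) \<in> interior R \<Longrightarrow> u y - u x = a \<bullet> (x, y) + \<alpha>"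
proof -
  obtain a b where ab: "\<And>x. x \<in> interior T \<inter> D \<Longrightarrow> u x = a \<bullet> x + b"
    using u simplex_index(1)[OF k] unfolding affine_fun_on_def by blast
  obtain a' b' where ab': "\<And>x. x \<in> interior S \<inter> D \<Longrightarrow> u x = a' \<bullet> x + b'"
    using u simplex_index(2)[OF k] unfolding affine_fun_on_def by blast
  show thesis
  \<comment> \<open>\<open>x\<close> ranges in one element and \<open>y\<close> in another, so each
    value follows one affine formula and the difference is affine in the \<open>2 d\<close> joint
    variables.\<close>
  proof (rule that[of "(- a, a')" "b' - b"])
    fix x y assume "(x, y) \<in> interior R"
    then show "u y - u x = (- a, a') \<bullet> (x, y) + (b' - b)"
      using interior_simplex[OF k] ab ab' by simp
  qed
qed

lemma simplex_contribution:
  assumes k: "(T, S, Z, R) \<in> simplex_indices" and u: "piecewise_affine u" and v: "piecewise_affine v"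
  shows "set_integrable lebesgue (interior R) (form_density u v)"
    and "(LINT p:interior R|lebesgue. form_density u v p) =
      (\<Sum>w | w extreme_point_of R. cell_average \<rho> Z * quad_weight (T, S, Z, R, w) *
        node_diff u (T, S, Z, R, w) * node_diff v (T, S, Z, R, w))"
proof -
  obtain a \<alpha> where a: "\<And>x y. (x, y) \<in> interior R \<Longrightarrow> u y - u x = a \<bullet> (x, y) + \<alpha>"
    using difference_affine[OF k u] by blast
  obtain b \<beta> where b: "\<And>x y. (x, y) \<in> interior R \<Longrightarrow> v y - v x = b \<bullet> (x, y) + \<beta>"
    using difference_affine[OF k v] by blast
  let ?f = "\<lambda>p. cell_average \<rho> Z * ((a \<bullet> p + \<alpha>) * (b \<bullet> p + \<beta>))"
  note R = simplex_index(7)[OF k]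
  have density: "form_density u v p = ?f p" if "p \<in> interior R" for p
  proof (cases p)
    case (Pair x y)
    then show ?thesis
      using a b averaged_kernel_interior[OF simplex_index(3)[OF k]] interior_simplex(3)[OF k] that by auto
  qed
  have eq: "indicator (interior R) p *\<^sub>R form_density u v p = indicator (interior R) p *\<^sub>R ?f p" for p
    using density by (simp add: indicator_def)
  have "set_integrable lebesgue (interior R) ?f"
    by (intro set_integrable_bounded_borel continuous_intros full_simplex_facts(6)[OF R]) auto
  then show "set_integrable lebesgue (interior R) (form_density u v)"
    unfolding set_integrable_def eq .
  have "(LINT p:interior R|lebesgue. form_density u v p) = (LINT p:interior R|lebesgue. ?f p)"
    unfolding set_lebesgue_integral_def eq ..
  also have "\<dots> = cell_average \<rho> Z * (LINT p:interior R|lebesgue. (a \<bullet> p + \<alpha>) * (b \<bullet> p + \<beta>))"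
    by simp
  also have "\<dots> = (\<Sum>w | w extreme_point_of R. cell_average \<rho> Z * quad_weight (T, S, Z, R, w) *
        node_diff u (T, S, Z, R, w) * node_diff v (T, S, Z, R, w))"
    unfolding pair_quadrature_exact[OF R, where T = T and S = S and Z = Z] sum_distrib_left
  proof (intro sum.cong refl)
    fix w assume "w \<in> {w. w extreme_point_of R}"
    \<comment> \<open>\<open>node_diff\<close> evaluates \<open>u\<close> itself, not its affine
      representative; the two agree at the node because it is an interior point.\<close>
    then have "quad_node (T, S, Z, R, w) \<in> interior R"
      using quad_node_interior[OF R] by blast
    then have "node_diff u (T, S, Z, R, w) = a \<bullet> quad_node (T, S, Z, R, w) + \<alpha>"
      "node_diff v (T, S, Z, R, w) = b \<bullet> quad_node (T, S, Z, R, w) + \<beta>"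
      using a b unfolding node_diff_def by (cases "quad_node (T, S, Z, R, w)"; simp)+
    then show "cell_average \<rho> Z * (quad_weight (T, S, Z, R, w) *
        ((a \<bullet> quad_node (T, S, Z, R, w) + \<alpha>) * (b \<bullet> quad_node (T, S, Z, R, w) + \<beta>))) =
      cell_average \<rho> Z * quad_weight (T, S, Z, R, w) * node_diff u (T, S, Z, R, w) * node_diff v (T, S, Z, R, w)"
      by (simp only: mult.assoc)
  qed
  finally show "(LINT p:interior R|lebesgue. form_density u v p) =
      (\<Sum>w | w extreme_point_of R. cell_average \<rho> Z * quad_weight (T, S, Z, R, w) *
        node_diff u (T, S, Z, R, w) * node_diff v (T, S, Z, R, w))" .
qed

text \<open>Only piecewise affinity is assumed, so that the possibly discontinuous lifting is
  covered. Integrability over \<open>\<I>\<close> is accordingly assembled from the finitely many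
  open simplices.\<close>

lemma nonlocal_form_assembly:
  assumes u: "piecewise_affine u" and v: "piecewise_affine v"
  shows "nonlocal_form \<kappa> \<Omega> P \<delta> u v =
    (\<Sum>\<nu>\<in>quad_indices \<Omega> P \<delta> \<T>' \<Z> \<R>. node_coeff \<rho> \<delta> \<nu> * node_diff u \<nu> * node_diff v \<nu>)"
proof -
  let ?E = "\<Union>k\<in>simplex_indices. simplex_interior k"
  define V where "V = (\<lambda>(T :: 'a set, S :: 'a set, Z :: 'a set, R :: ('a \<times> 'a) set). {w. w extreme_point_of R})"
  \<comment> \<open>Reassociates a simplex and one of its vertices into a five-component quadrature
    index, so that the iterated sum becomes a single sum over \<open>quad_indices\<close>.\<close>
  define \<iota> where "\<iota> = (\<lambda>((T :: 'a set, S :: 'a set, Z :: 'a set, R :: ('a \<times> 'a) set), w :: 'a \<times> 'a). (T, S, Z, R, w))"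
  define c where "c \<nu> = cell_average \<rho> (quad_cell \<nu>) * quad_weight \<nu> * node_diff u \<nu> * node_diff v \<nu>" for \<nu>
  have part: "set_integrable lebesgue (simplex_interior k) (form_density u v)"
    "(LINT p:simplex_interior k|lebesgue. form_density u v p) = (\<Sum>w\<in>V k. c (\<iota> (k, w)))"
    if "k \<in> simplex_indices" for k
  proof -
    obtain T S Z R where k: "k = (T, S, Z, R)"
      by (cases k)
    show "set_integrable lebesgue (simplex_interior k) (form_density u v)"
      "(LINT p:simplex_interior k|lebesgue. form_density u v p) = (\<Sum>w\<in>V k. c (\<iota> (k, w)))"
      using simplex_contribution[OF that[unfolded k] u v]
      by (simp_all add: k simplex_interior_def V_def \<iota>_def c_def del: quad_weight.simps)
  qed
  have meas: "simplex_interior k \<in> sets lebesgue" for k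
    by (auto simp: simplex_interior_def split: prod.split)
  have fin: "finite (V k)" if "k \<in> simplex_indices" for k
  proof -
    obtain T S Z R where k: "k = (T, S, Z, R)"
      by (cases k)
    have "int DIM('a \<times> 'a) simplex R"
      using simplex_index(7) that unfolding k by blast
    then have "polytope R"
      by (rule simplex_imp_polytope)
    then show ?thesis
      unfolding V_def k by (simp add: finite_polyhedron_extreme_points polytope_imp_polyhedron)
  qed
  have "set_integrable lebesgue ?E (form_density u v)"
    using finite_simplex_indices part(1) meas by (intro set_integrable_UN) auto
  then have "(LINT p:\<I>|lebesgue. form_density u v p) = (LINT p:?E|lebesgue. form_density u v p)"
    using Union_simplex_interiors by (intro set_lebesgue_integral_spike_set(2))
  also have "\<dots> = (\<Sum>k\<in>simplex_indices. LINT p:simplex_interior k|lebesgue. form_density u v p)"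
    using finite_simplex_indices disjoint_simplex_interiors part(1) meas
    by (intro set_integral_finite_Union) auto
  also have "\<dots> = (\<Sum>k\<in>simplex_indices. \<Sum>w\<in>V k. c (\<iota> (k, w)))"
    using part(2) by (intro sum.cong) auto
  also have "\<dots> = (\<Sum>q\<in>Sigma simplex_indices V. c (\<iota> q))"
    using finite_simplex_indices fin by (subst sum.Sigma) auto
  also have "\<dots> = (\<Sum>\<nu>\<in>\<iota> ` Sigma simplex_indices V. c \<nu>)"
    by (subst sum.reindex) (auto simp: inj_on_def \<iota>_def)
  also have "\<iota> ` Sigma simplex_indices V = quad_indices \<Omega> P \<delta> \<T>' \<Z> \<R>"
  proof -
    have "(T, S, Z, R, w) \<in> \<iota> ` Sigma simplex_indices V"
      if "(T, S, Z, R, w) \<in> quad_indices \<Omega> P \<delta> \<T>' \<Z> \<R>" for T S Z R w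
      by (rule image_eqI[of _ _ "((T, S, Z, R), w)"])
         (use that in \<open>auto simp: \<iota>_def V_def quad_indices_def simplex_indices_def\<close>)
    moreover have "\<iota> ` Sigma simplex_indices V \<subseteq> quad_indices \<Omega> P \<delta> \<T>' \<Z> \<R>"
      by (auto simp: \<iota>_def V_def quad_indices_def simplex_indices_def)
    ultimately show ?thesis
      by (intro equalityI subrelI) auto
  qed
  finally show ?thesis
    unfolding nonlocal_form_def
    by (simp add: c_def node_coeff_def sum_distrib_left mult.assoc)
qed

end

theorem proposition4p1:
  fixes \<Omega> P :: "'a::euclidean_space set"
    and \<rho> :: "'a \<Rightarrow> real"
    and M\<^sub>\<rho> \<rho>\<^sub>s r\<^sub>s :: real
    and \<Z> \<T> :: "'a set set"
    and \<TT> :: "'a set set set"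
    and N :: nat
    and \<phi> :: "nat \<Rightarrow> 'a \<Rightarrow> real"
  assumes "lipschitz_polyhedral_domain \<Omega>"
    and "0 < M\<^sub>\<rho>" "0 < \<rho>\<^sub>s" "0 < r\<^sub>s" "r\<^sub>s \<le> 1"
    and "set_integrable lebesgue (ball 0 1) \<rho>"
    and "AE z in lebesgue. z \<in> ball 0 1 \<longrightarrow> \<rho> (- z) = \<rho> z"
    and "AE z in lebesgue. z \<in> ball 0 1 \<longrightarrow> 0 \<le> \<rho> z"
    and "(LINT z:ball 0 1|lebesgue. \<bar>\<rho> z\<bar>) \<le> M\<^sub>\<rho>"
    and "AE z in lebesgue. z \<in> ball 0 r\<^sub>s \<longrightarrow> \<rho>\<^sub>s \<le> \<rho> z"
    and "polytope P" "aff_dim P = int DIM('a)" "uminus ` P = P"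
    and "ball 0 (1/2) \<subseteq> P" "P \<subseteq> cball 0 1"
    and "polytopal_partition P \<Z>" "\<forall>Z\<in>\<Z>. uminus ` Z \<in> \<Z>"
    and "0 < Max (diameter ` \<Z>)" "Max (diameter ` \<Z>) \<le> r\<^sub>s / 2"
    and "\<forall>\<T>'\<in>\<TT>. conforming_mesh \<Omega> \<T>'"
    and "uniformly_shape_regular \<TT>" "globally_quasi_uniform \<TT>"
    and "\<T> \<in> \<TT>"
    and "nodal_basis \<Omega> \<T> N \<phi>"
  shows "(\<forall>z. averaged_kernel \<rho> \<Z> (- z) = averaged_kernel \<rho> \<Z> z) \<and>
    (\<forall>z. 0 \<le> averaged_kernel \<rho> \<Z> z) \<and>
    set_integrable lebesgue (ball 0 1) (averaged_kernel \<rho> \<Z>) \<and>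
    (LINT z:ball 0 1|lebesgue. \<bar>averaged_kernel \<rho> \<Z> z\<bar>) \<le> M\<^sub>\<rho> \<and>
    (AE z in lebesgue. z \<in> ball 0 (r\<^sub>s / 2) \<longrightarrow> \<rho>\<^sub>s \<le> averaged_kernel \<rho> \<Z> z) \<and>
    (\<forall>\<delta>>0.
       sym_positive_definite N (stiffness_matrix (averaged_kernel \<rho> \<Z>) \<Omega> P \<delta> \<phi>) \<and>
       (\<forall>\<T>' g \<R>.
          extension_mesh \<Omega> P \<delta> \<T> \<T>' \<and> collar_data \<Omega> P \<delta> \<T>' g \<and>
          pair_cell_subdivision \<Omega> P \<delta> \<T>' \<Z> \<R> \<longrightarrow>
          (\<forall>i\<in>{1..N}. \<forall>j\<in>{1..N}.
             stiffness_matrix (averaged_kernel \<rho> \<Z>) \<Omega> P \<delta> \<phi> i j =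
             (\<Sum>\<nu>\<in>quad_indices \<Omega> P \<delta> \<T>' \<Z> \<R>.
                node_coeff \<rho> \<delta> \<nu> * node_diff (zero_ext \<Omega> (\<phi> i)) \<nu>
                                * node_diff (zero_ext \<Omega> (\<phi> j)) \<nu>)) \<and>
          (\<forall>i\<in>{1..N}.
             lifting_load (averaged_kernel \<rho> \<Z>) \<Omega> P \<delta> g \<phi> i =
             - (\<Sum>\<nu>\<in>quad_indices \<Omega> P \<delta> \<T>' \<Z> \<R>.
                  node_coeff \<rho> \<delta> \<nu> * node_diff (lifting \<Omega> P \<delta> g) \<nu>
                                  * node_diff (zero_ext \<Omega> (\<phi> i)) \<nu>))))"
proof -
  interpret symmetric_kernel_partition \<rho> P \<Z>
    using assms by unfold_locales
  note low = assms(10)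
  have main: "sym_positive_definite N (stiffness_matrix \<kappa> \<Omega> P \<delta> \<phi>) \<and>
       (\<forall>\<T>' g \<R>.
          extension_mesh \<Omega> P \<delta> \<T> \<T>' \<and> collar_data \<Omega> P \<delta> \<T>' g \<and>
          pair_cell_subdivision \<Omega> P \<delta> \<T>' \<Z> \<R> \<longrightarrow>
          (\<forall>i\<in>{1..N}. \<forall>j\<in>{1..N}.
             stiffness_matrix \<kappa> \<Omega> P \<delta> \<phi> i j =
             (\<Sum>\<nu>\<in>quad_indices \<Omega> P \<delta> \<T>' \<Z> \<R>.
                node_coeff \<rho> \<delta> \<nu> * node_diff (zero_ext \<Omega> (\<phi> i)) \<nu>
                                * node_diff (zero_ext \<Omega> (\<phi> j)) \<nu>)) \<and>
          (\<forall>i\<in>{1..N}.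
             lifting_load \<kappa> \<Omega> P \<delta> g \<phi> i =
             - (\<Sum>\<nu>\<in>quad_indices \<Omega> P \<delta> \<T>' \<Z> \<R>.
                  node_coeff \<rho> \<delta> \<nu> * node_diff (lifting \<Omega> P \<delta> g) \<nu>
                                  * node_diff (zero_ext \<Omega> (\<phi> i)) \<nu>)))"
    if \<delta>: "0 < \<delta>" for \<delta>
  proof (intro conjI allI impI; (elim conjE)?)
    interpret nonlocal_problem \<rho> P \<Z> \<Omega> \<delta>
      using assms(1) \<delta> by unfold_locales
    show "sym_positive_definite N (stiffness_matrix \<kappa> \<Omega> P \<delta> \<phi>)"
      using stiffness_matrix_spd[OF assms(24,4,5,19,3) low] .
    fix \<T>' g \<R>
    assume mesh': "extension_mesh \<Omega> P \<delta> \<T> \<T>'" and g: "collar_data \<Omega> P \<delta> \<T>' g"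
      and sub: "pair_cell_subdivision \<Omega> P \<delta> \<T>' \<Z> \<R>"
    interpret pair_cell_assembly \<rho> P \<Z> \<Omega> \<delta> \<T> \<T>' \<R>
      using assms(20,23) mesh' sub by unfold_locales auto
    have \<phi>: "piecewise_affine (zero_ext \<Omega> (\<phi> i))" if "i \<in> {1..N}" for i
      using assms(24) that zero_ext_affine unfolding nodal_basis_def by blast
    have g_affine: "piecewise_affine (lifting \<Omega> P \<delta> g)"
      using lifting_affine[OF g] by blast
    show "\<forall>i\<in>{1..N}. \<forall>j\<in>{1..N}. stiffness_matrix \<kappa> \<Omega> P \<delta> \<phi> i j =
        (\<Sum>\<nu>\<in>quad_indices \<Omega> P \<delta> \<T>' \<Z> \<R>.
           node_coeff \<rho> \<delta> \<nu> * node_diff (zero_ext \<Omega> (\<phi> i)) \<nu> * node_diff (zero_ext \<Omega> (\<phi> j)) \<nu>)"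
    proof (intro ballI)
      fix i j assume ij: "i \<in> {1..N}" "j \<in> {1..N}"
      \<comment> \<open>\<open>stiffness_matrix\<close> puts \<open>\<phi> j\<close> in the first
        slot of the form; symmetry brings the two differences into the order of the claimed
        sum.\<close>
      have "stiffness_matrix \<kappa> \<Omega> P \<delta> \<phi> i j =
          nonlocal_form \<kappa> \<Omega> P \<delta> (zero_ext \<Omega> (\<phi> i)) (zero_ext \<Omega> (\<phi> j))"
        unfolding stiffness_matrix_def by (rule nonlocal_form_commute)
      then show "stiffness_matrix \<kappa> \<Omega> P \<delta> \<phi> i j =
          (\<Sum>\<nu>\<in>quad_indices \<Omega> P \<delta> \<T>' \<Z> \<R>.
             node_coeff \<rho> \<delta> \<nu> * node_diff (zero_ext \<Omega> (\<phi> i)) \<nu> * node_diff (zero_ext \<Omega> (\<phi> j)) \<nu>)"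
        using nonlocal_form_assembly[OF \<phi>[OF ij(1)] \<phi>[OF ij(2)]] by (rule trans)
    qed
    show "\<forall>i\<in>{1..N}. lifting_load \<kappa> \<Omega> P \<delta> g \<phi> i =
        - (\<Sum>\<nu>\<in>quad_indices \<Omega> P \<delta> \<T>' \<Z> \<R>.
             node_coeff \<rho> \<delta> \<nu> * node_diff (lifting \<Omega> P \<delta> g) \<nu> * node_diff (zero_ext \<Omega> (\<phi> i)) \<nu>)"
      unfolding lifting_load_def by (intro ballI arg_cong[of _ _ uminus] nonlocal_form_assembly g_affine \<phi>)
  qed
  show ?thesis
    using main
    by (intro conjI[OF _ conjI[OF _ conjI[OF _ conjI[OF _ conjI]]]] allI impI averaged_kernel_even
        averaged_kernel_nonneg averaged_kernel_set_integrable order_trans[OF averaged_kernel_L1_le assms(9)]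
        averaged_kernel_lower_bound[OF assms(4,5,19) low]) simp
qed

end
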